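(* Suppose $p=p_n$ satisfies $\frac{\log p}{n}\to 0$ as $n\to\infty$. For each $n$ let $\mathbf{X}_1,\dots,\mathbf{X}_p$ be independent $n$-dimensional random vectors with a common spherical distribution (which may depend on $n$) satisfying $P(\mathbf{X}_1=\mathbf{0})=0$, and let $L_n=\max_{1\le i<j\le p}|\rho_{ij}|$, where $\rho_{ij}$ is the Pearson correlation coefficient of $\mathbf{X}_i$ and $\mathbf{X}_j$. Then: (i) $L_n\to 0$ in probability as $n\to\infty$. (ii) Let $T_n=\log(1-L_n^2)$. Then, as $n\to\infty$, $nT_n+4\log p-\log\log p$ converges weakly to an extreme distribution with the distribution function $F(y)=1-e^{-Ke^{y/2}}$, $y\in\mathbb{R}$, where $K=1/\sqrt{8\pi}$.
   Context: A random vector $\mathbf{Y}\in\mathbb{R}^n$ has a spherical distribution if $\mathbf{O}\mathbf{Y}$ and $\mathbf{Y}$ have the same probability distribution for every $n\times n$ orthogonal matrix $\mathbf{O}$. For $\mathbf{x}=(x_1,\dots,x_n)^T$, $\mathbf{y}=(y_1,\dots,y_n)^T\in\mathbb{R}^n$, the Pearson correlation coefficient is $$\rho_{\mathbf{x},\mathbf{y}}=\frac{\sum_{i=1}^n(x_i-\bar x)(y_i-\bar y)}{\sqrt{\sum_{i=1}^n(x_i-\bar x)^2\cdot\sum_{i=1}^n(y_i-\bar y)^2}},\qquad \bar x=\frac1n\sum_{i=1}^n x_i,\quad \bar y=\frac1n\sum_{i=1}^n y_i,$$ and $\rho_{ij}=\rho_{\mathbf{X}_i,\mathbf{X}_j}$.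 $\log$ is the natural logarithm, and $p=p_n$ depends on $n$ only.
   Formalization: Part (ii) is proved under the additional assumption that p_n → ∞, without which it fails (for constant p = 2 the variable nT_n + 4 log p − log log p is bounded above, while F(y) < 1 for all y). *)

theory Defs
  imports "HOL-Probability.Probability"
begin

text \<open>
  The dimension varies along the sequence, so a vector of \<open>\<real>\<^sup>n\<close> is a function
  with domain \<open>{1..n}\<close>, that is, a point of the product space below. Its product sigma-algebra is
  the Borel sigma-algebra of \<open>\<real>\<^sup>n\<close>. Matrices are functions of two indices; only
  their entries with indices in \<open>{1..n}\<close> are used.
\<close>

abbreviation Rn :: "nat \<Rightarrow> (nat \<Rightarrow> real) measure" where
  "Rn n \<equiv> PiM {1..n} (\<lambda>_. borel)"

definition orthogonal_entries :: "nat \<Rightarrow> (nat \<Rightarrow> nat \<Rightarrow> real) \<Rightarrow> bool" where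
  "orthogonal_entries n Q \<longleftrightarrow>
     (\<forall>i\<in>{1..n}. \<forall>j\<in>{1..n}. (\<Sum>k=1..n. Q k i * Q k j) = (if i = j then 1 else 0)) \<and>
     (\<forall>i\<in>{1..n}. \<forall>j\<in>{1..n}. (\<Sum>k=1..n. Q i k * Q j k) = (if i = j then 1 else 0))"

definition matvec :: "nat \<Rightarrow> (nat \<Rightarrow> nat \<Rightarrow> real) \<Rightarrow> (nat \<Rightarrow> real) \<Rightarrow> (nat \<Rightarrow> real)" where
  "matvec n Q y = (\<lambda>i\<in>{1..n}. \<Sum>j=1..n. Q i j * y j)"

definition spherical :: "'a measure \<Rightarrow> nat \<Rightarrow> ('a \<Rightarrow> nat \<Rightarrow> real) \<Rightarrow> bool" where
  "spherical M n Y \<longleftrightarrow> Y \<in> measurable M (Rn n) \<and>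
     (\<forall>Q. orthogonal_entries n Q \<longrightarrow>
        distr M (Rn n) (\<lambda>\<omega>. matvec n Q (Y \<omega>)) = distr M (Rn n) Y)"

definition mean :: "nat \<Rightarrow> (nat \<Rightarrow> real) \<Rightarrow> real" where
  "mean n x = (1 / real n) * (\<Sum>i=1..n. x i)"

definition pearson :: "nat \<Rightarrow> (nat \<Rightarrow> real) \<Rightarrow> (nat \<Rightarrow> real) \<Rightarrow> real" where
  "pearson n x y =
     (\<Sum>i=1..n. (x i - mean n x) * (y i - mean n y)) /
     sqrt ((\<Sum>i=1..n. (x i - mean n x)\<^sup>2) * (\<Sum>i=1..n. (y i - mean n y)\<^sup>2))"

text \<open>For \<open>p < 2\<close> the maximum is over the empty set and carries no meaning.\<close>

definition max_abs_corr :: "nat \<Rightarrow> nat \<Rightarrow> (nat \<Rightarrow> nat \<Rightarrow> real) \<Rightarrow> real" where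
  "max_abs_corr n p x = Max {\<bar>pearson n (x i) (x j)\<bar> | i j. 1 \<le> i \<and> i < j \<and> j \<le> p}"

end

theory Submission
  imports Defs "HOL-Real_Asymp.Real_Asymp"
begin

text \<open>
  Write \<open>V\<^sub>k\<close> for the centred vector \<open>X\<^sub>k\<close> scaled to length 1, so that \<open>\<rho>\<^sub>i\<^sub>j\<close> is the inner product of
  \<open>V\<^sub>i\<close> and \<open>V\<^sub>j\<close>. The law of \<open>V\<^sub>j\<close> is invariant under the orthogonal maps that fix the vector of ones;
  hence the law of \<open>\<langle>u, V\<^sub>j\<rangle>\<close> is the same for every unit vector \<open>u\<close> orthogonal to the ones. Given
  \<open>X\<^sub>i\<close>, all \<open>\<rho>\<^sub>i\<^sub>j\<close> with \<open>j \<noteq> i\<close> are therefore independent with a law that does not depend on \<open>X\<^sub>i\<close>, and the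
  events \<open>\<bar>\<rho>\<^sub>i\<^sub>j\<bar> \<ge> t\<close> all have the same probability \<open>q\<close>, are independent for disjoint pairs, and
  are even pairwise independent when two pairs share an index (\<open>prob_corr_event_Int\<close>).

  The common law is found by moments: comparing the coefficients of \<open>\<tau>\<^sup>2\<close> in
  \<open>E \<langle>u + \<tau> w, V\<rangle>\<^sup>2\<^sup>k = \<bar>u + \<tau> w\<bar>\<^sup>2\<^sup>k E \<langle>u, V\<rangle>\<^sup>2\<^sup>k\<close> and summing over the centred coordinate vectors
  \<open>w\<close> gives a recurrence (\<open>moment_recurrence\<close>), which the density proportional to
  \<open>(1 - r\<^sup>2)\<^bsup>(n - 4) / 2\<^esup>\<close> on \<open>[-1, 1]\<close> satisfies as well; on a bounded interval the moments
  determine the law.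

  The probability that no pair exceeds the level \<open>t\<close> is then compared with \<open>exp (- \<Lambda>)\<close>, where
  \<open>\<Lambda> = p (p - 1) q / 2\<close>, by a generating function version of the Chen-Stein method
  (\<open>void_probability_close_to_exp\<close>): the function \<open>s \<mapsto> E s\<^sup>W\<close> of the number \<open>W\<close> of exceedances almost
  solves \<open>\<phi>' = \<Lambda> \<phi>\<close>, and since all pairs of events are independent the error is of order
  \<open>p\<^sup>3 q\<^sup>2\<close>. At the level that corresponds to \<open>n T + 4 ln p - ln ln p = y\<close>, Wallis' product and an
  analogue of Mills' ratio for the explicit density give \<open>\<Lambda> \<rightarrow> K exp (y / 2)\<close>
  (\<open>pairs_times_corr_tail_critical\<close>); then \<open>q\<close> is of order \<open>p\<^sup>-\<^sup>2\<close> and the error tends to 0. For a fixed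
  level \<open>q\<close> decays exponentially in \<open>n\<close>, and \<open>p\<^sup>2 q\<close> tends to 0 because \<open>ln p\<close> is of smaller
  order than \<open>n\<close>; this is the convergence in probability.
\<close>

section \<open>Reflections and centred directions\<close>

text \<open>
  Keeping the numeral \<open>1\<close> leaves the index set \<open>{1..n}\<close> of the product spaces in the same syntactic form
  everywhere.
\<close>

declare One_nat_def [simp del]

definition dot :: "nat \<Rightarrow> (nat \<Rightarrow> real) \<Rightarrow> (nat \<Rightarrow> real) \<Rightarrow> real" where
  "dot n x y = (\<Sum>i=1..n. x i * y i)"

text \<open>
  For a constant vector the division by zero yields the zero vector, matching the value 0 of
  \<open>pearson\<close> in that case.
\<close>

definition centered_dir :: "nat \<Rightarrow> (nat \<Rightarrow> real) \<Rightarrow> nat \<Rightarrow> real" where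
  "centered_dir n x i = (x i - mean n x) / sqrt (\<Sum>i=1..n. (x i - mean n x)\<^sup>2)"

lemma pearson_eq_dot: "pearson n x y = dot n (centered_dir n x) (centered_dir n y)"
  by (simp add: pearson_def dot_def centered_dir_def real_sqrt_mult sum_divide_distrib)

lemma dot_commute: "dot n x y = dot n y x"
  by (simp add: dot_def mult.commute)

lemma dot_add_left: "dot n (\<lambda>i. x i + y i) z = dot n x z + dot n y z"
  by (simp add: dot_def algebra_simps sum.distrib)

lemma dot_diff_left: "dot n (\<lambda>i. x i - y i) z = dot n x z - dot n y z"
  by (simp add: dot_def algebra_simps sum_subtractf)

lemma dot_scale_left: "dot n (\<lambda>i. c * x i) z = c * dot n x z"
  by (simp add: dot_def sum_distrib_left mult.assoc)

lemma dot_add_right: "dot n z (\<lambda>i. x i + y i) = dot n z x + dot n z y"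
  by (simp add: dot_def algebra_simps sum.distrib)

lemma dot_diff_right: "dot n z (\<lambda>i. x i - y i) = dot n z x - dot n z y"
  by (simp add: dot_def algebra_simps sum_subtractf)

lemma dot_scale_right: "dot n z (\<lambda>i. c * x i) = c * dot n z x"
  by (simp add: dot_def sum_distrib_left algebra_simps)

lemmas dot_linear = dot_add_left dot_diff_left dot_scale_left
  dot_add_right dot_diff_right dot_scale_right

lemma dot_cong:
  "(\<And>i. i \<in> {1..n} \<Longrightarrow> x i = x' i) \<Longrightarrow> (\<And>i. i \<in> {1..n} \<Longrightarrow> y i = y' i) \<Longrightarrow> dot n x y = dot n x' y'"
  by (simp add: dot_def)

lemma dot_self_nonneg: "dot n x x \<ge> 0"
  by (simp add: dot_def sum_nonneg)

lemma dot_self_eq_0_iff: "dot n x x = 0 \<longleftrightarrow> (\<forall>i\<in>{1..n}. x i = 0)"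
  unfolding dot_def by (subst sum_nonneg_eq_0_iff) auto

lemma dot_Cauchy_Schwarz: "\<bar>dot n x y\<bar> \<le> sqrt (dot n x x) * sqrt (dot n y y)"
proof -
  have "\<bar>dot n x y\<bar> \<le> (\<Sum>i=1..n. \<bar>x i\<bar> * \<bar>y i\<bar>)"
    unfolding dot_def by (rule order_trans[OF sum_abs]) (simp add: abs_mult)
  also have "\<dots> \<le> L2_set x {1..n} * L2_set y {1..n}"
    by (rule L2_set_mult_ineq)
  finally show ?thesis
    by (simp add: L2_set_def dot_def power2_eq_square)
qed

lemma matvec_nth: "i \<in> {1..n} \<Longrightarrow> matvec n Q x i = (\<Sum>j=1..n. Q i j * x j)"
  by (simp add: matvec_def)

lemma dot_matvec:
  assumes "orthogonal_entries n Q"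
  shows "dot n (matvec n Q x) (matvec n Q y) = dot n x y"
proof -
  have "dot n (matvec n Q x) (matvec n Q y) =
      (\<Sum>i=1..n. (\<Sum>j=1..n. Q i j * x j) * (\<Sum>k=1..n. Q i k * y k))"
    unfolding dot_def by (intro sum.cong) (auto simp: matvec_nth)
  also have "\<dots> = (\<Sum>i=1..n. \<Sum>j=1..n. \<Sum>k=1..n. Q i j * x j * (Q i k * y k))"
    by (simp add: sum_product)
  also have "\<dots> = (\<Sum>j=1..n. \<Sum>i=1..n. \<Sum>k=1..n. Q i j * x j * (Q i k * y k))"
    by (rule sum.swap)
  also have "\<dots> = (\<Sum>j=1..n. \<Sum>k=1..n. \<Sum>i=1..n. Q i j * x j * (Q i k * y k))"
    by (rule sum.cong[OF refl], rule sum.swap)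
  also have "\<dots> = (\<Sum>j=1..n. \<Sum>k=1..n. x j * y k * (\<Sum>i=1..n. Q i j * Q i k))"
    by (simp add: sum_distrib_left algebra_simps)
  also have "\<dots> = (\<Sum>j=1..n. \<Sum>k=1..n. x j * y k * (if j = k then 1 else 0))"
    by (intro sum.cong refl) (use assms in \<open>auto simp: orthogonal_entries_def\<close>)
  also have "\<dots> = (\<Sum>j=1..n. x j * y j)"
    by (intro sum.cong refl) (simp add: if_distrib cong: if_cong)
  finally show ?thesis by (simp add: dot_def)
qed

text \<open>
  The reflection in the hyperplane orthogonal to \<open>u - v\<close>. For \<open>u = v\<close> its coefficient \<open>2 / 0\<close> is 0, so
  the same formula gives the identity.
\<close>

lemma reflection_exists:
  assumes norm_eq: "dot n u u = dot n v v"
  shows "\<exists>Q. orthogonal_entries n Q \<and> (\<forall>i\<in>{1..n}. matvec n Q u i = v i) \<and>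
    (\<forall>x. dot n u x = dot n v x \<longrightarrow> (\<forall>i\<in>{1..n}. matvec n Q x i = x i))"
proof -
  define w where "w = (\<lambda>i. u i - v i)"
  define c where "c = 2 / dot n w w"
  define Q where "Q = (\<lambda>i j. (if i = j then 1 else 0) - c * w i * w j)"
  have w_eq: "dot n w x = dot n u x - dot n v x" for x
    by (simp add: w_def dot_linear)
  have ww: "dot n w w = 2 * dot n w u"
    using norm_eq by (simp add: w_def dot_linear dot_commute[of n v u])
  have c2: "c * c * dot n w w = 2 * c"
    by (simp add: c_def power2_eq_square)
  have Qx: "matvec n Q x i = x i - c * dot n w x * w i" if "i \<in> {1..n}" for x i
  proof -
    have "matvec n Q x i = (\<Sum>j=1..n. (if i = j then x j else 0) - c * w i * (w j * x j))"
      unfolding matvec_nth[OF that] Q_def by (intro sum.cong) (auto simp: algebra_simps)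
    also have "\<dots> = x i - c * w i * dot n w x"
      using that by (simp add: sum_subtractf dot_def sum_distrib_left)
    finally show ?thesis by (simp add: algebra_simps)
  qed
  have QQ: "(\<Sum>k=1..n. Q i k * Q j k) = (if i = j then 1 else 0)" if "i \<in> {1..n}" "j \<in> {1..n}" for i j
  proof -
    have "(\<Sum>k=1..n. Q i k * Q j k) = matvec n Q (Q j) i"
      by (simp only: matvec_nth[OF that(1)])
    also have "\<dots> = Q j i - c * dot n w (Q j) * w i"
      by (rule Qx) fact
    also have "dot n w (Q j) = matvec n Q w j"
      using that by (simp add: matvec_nth dot_def mult.commute)
    also have "\<dots> = w j - c * dot n w w * w j"
      by (rule Qx) fact
    also have "Q j i - c * (w j - c * dot n w w * w j) * w i
        = (if i = j then 1 else 0) - 2 * c * w i * w j + (c * c * dot n w w) * (w i * w j)"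
      by (simp add: Q_def algebra_simps)
    also have "\<dots> = (if i = j then 1 else 0)"
      unfolding c2 by simp
    finally show ?thesis .
  qed
  have Q_sym: "Q i j = Q j i" for i j
    by (simp add: Q_def)
  show ?thesis
  proof (intro exI[of _ Q] conjI ballI allI impI)
    show "orthogonal_entries n Q"
      using QQ by (auto simp: orthogonal_entries_def Q_sym[of _ i for i])
  next
    fix i assume i: "i \<in> {1..n}"
    show "matvec n Q u i = v i"
    proof (cases "dot n w w = 0")
      case True
      then have "w i = 0"
        using i dot_self_eq_0_iff by blast
      then show ?thesis
        using i by (simp add: Qx w_def)
    next
      case False
      then have "c * dot n w u = 1"
        by (simp add: c_def ww)
      then show ?thesis
        using i by (simp add: Qx w_def)
    qed
  next
    fix x i assume "i \<in> {1..n}" "dot n u x = dot n v x"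
    then show "matvec n Q x i = x i"
      by (simp add: Qx w_eq)
  qed
qed

lemma mean_eq_dot: "mean n x = dot n (\<lambda>_. 1) x / real n"
  by (simp add: mean_def dot_def)

lemma sum_power2_eq_dot: "(\<Sum>i=1..n. (f i)\<^sup>2) = dot n f f"
  by (simp add: dot_def power2_eq_square)

text \<open>
  An isometry that fixes the vector of ones preserves means and lengths, so it commutes with centring
  and with scaling to unit length.
\<close>

lemma centered_dir_matvec:
  assumes Q: "orthogonal_entries n Q" and one: "\<And>i. i \<in> {1..n} \<Longrightarrow> matvec n Q (\<lambda>_. 1) i = 1"
    and i: "i \<in> {1..n}"
  shows "centered_dir n (matvec n Q y) i = matvec n Q (centered_dir n y) i"
proof -
  have "dot n (\<lambda>_. 1) (matvec n Q y) = dot n (matvec n Q (\<lambda>_. 1)) (matvec n Q y)"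
    by (rule dot_cong) (simp_all add: one)
  then have mean: "mean n (matvec n Q y) = mean n y"
    by (simp add: mean_eq_dot dot_matvec[OF Q])
  let ?c = "\<lambda>i. y i - mean n y"
  have lin: "matvec n Q (\<lambda>i. (y i - m) * s) i = (matvec n Q y i - m) * s" if "i \<in> {1..n}" for i m s
  proof -
    have "(\<Sum>j=1..n. Q i j) = 1"
      using one[OF that] that by (simp add: matvec_nth)
    moreover have "matvec n Q (\<lambda>i. (y i - m) * s) i = matvec n Q y i * s - m * s * (\<Sum>j=1..n. Q i j)"
      using that by (simp add: matvec_nth algebra_simps sum_subtractf sum_distrib_left)
    ultimately show ?thesis
      by (simp add: algebra_simps)
  qed
  have "(\<Sum>i=1..n. (matvec n Q y i - mean n y)\<^sup>2) = dot n (matvec n Q ?c) (matvec n Q ?c)"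
    unfolding sum_power2_eq_dot by (rule dot_cong) (use lin[of _ "mean n y" 1] in simp_all)
  also have "\<dots> = (\<Sum>i=1..n. (?c i)\<^sup>2)"
    by (simp only: dot_matvec[OF Q] sum_power2_eq_dot)
  finally show ?thesis
    unfolding centered_dir_def mean
    using lin[OF i, of "mean n y" "inverse (sqrt (\<Sum>i=1..n. (?c i)\<^sup>2))"]
    by (simp add: divide_inverse)
qed

lemma dot_one_centered_dir: "n \<ge> 1 \<Longrightarrow> dot n (\<lambda>_. 1) (centered_dir n x) = 0"
  by (simp add: dot_def centered_dir_def mean_def sum_subtractf flip: sum_divide_distrib)

lemma dot_centered_dir_self:
  "dot n (centered_dir n x) (centered_dir n x) = (if \<forall>i\<in>{1..n}. x i = mean n x then 0 else 1)"
proof -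
  let ?s = "\<Sum>i=1..n. (x i - mean n x)\<^sup>2"
  have "?s \<ge> 0" by (simp add: sum_nonneg)
  have "dot n (centered_dir n x) (centered_dir n x) = (\<Sum>i=1..n. (x i - mean n x)\<^sup>2 / ?s)"
    unfolding dot_def centered_dir_def using \<open>?s \<ge> 0\<close> by (simp add: power2_eq_square)
  also have "\<dots> = ?s / ?s"
    by (simp flip: sum_divide_distrib)
  also have "\<dots> = (if \<forall>i\<in>{1..n}. x i = mean n x then 0 else 1)"
    by (subst divide_self_if, subst sum_nonneg_eq_0_iff) auto
  finally show ?thesis .
qed

lemma abs_dot_centered_dir_le_1: "dot n u u \<le> 1 \<Longrightarrow> \<bar>dot n u (centered_dir n x)\<bar> \<le> 1"
  using dot_Cauchy_Schwarz[of n u "centered_dir n x"]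
  by (rule order_trans) (auto simp: dot_centered_dir_self)

lemma abs_pearson_le_1: "\<bar>pearson n x y\<bar> \<le> 1"
  unfolding pearson_eq_dot by (rule abs_dot_centered_dir_le_1) (simp add: dot_centered_dir_self)

section \<open>Moments of the inner product with a spherical direction\<close>

lemma matvec_measurable [measurable]: "matvec n Q \<in> measurable (Rn n) (Rn n)"
  unfolding matvec_def[abs_def] by measurable

lemma mean_measurable [measurable]: "mean n \<in> borel_measurable (Rn n)"
  unfolding mean_def[abs_def] by measurable

lemma centered_dir_measurable [measurable]:
  "i \<in> {1..n} \<Longrightarrow> (\<lambda>y. centered_dir n y i) \<in> borel_measurable (Rn n)"
  unfolding centered_dir_def by measurable

lemma dot_centered_dir_measurable [measurable]:
  "(\<lambda>y. dot n u (centered_dir n y)) \<in> borel_measurable (Rn n)"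
  unfolding dot_def by measurable

text \<open>
  With \<open>b = 2 \<langle>u, w\<rangle>\<close> and \<open>e = \<bar>w\<bar>\<^sup>2\<close> the base is \<open>\<bar>u + \<tau> w\<bar>\<^sup>2\<close> as a polynomial in \<open>\<tau>\<close>, for a unit vector
  \<open>u\<close>; the coefficient of \<open>\<tau>\<^sup>2\<close> is what \<open>mixed_moment\<close> compares.
\<close>

lemma coeff_quadratic_power:
  fixes b e :: real
  shows "coeff ([:1, b, e:] ^ k) 0 = 1 \<and> coeff ([:1, b, e:] ^ k) 1 = real k * b \<and>
    coeff ([:1, b, e:] ^ k) 2 = real k * e + b\<^sup>2 * real k * (real k - 1) / 2"
proof (induction k)
  case 0
  show ?case by simp
next
  case (Suc k)
  let ?p = "[:1, b, e:] ^ k"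
  have "coeff ([:1, b, e:] ^ Suc k) i = coeff ?p i + b * (if i \<ge> 1 then coeff ?p (i - 1) else 0)
      + e * (if i \<ge> 2 then coeff ?p (i - 2) else 0)" for i
    by (cases i; cases "i - 1") (auto simp: coeff_pCons)
  from this[of 0] this[of 1] this[of 2] Suc show ?case
    by (simp only:) (simp add: One_nat_def field_simps power2_eq_square)
qed

locale spherical_law = prob_space N for N :: "(nat \<Rightarrow> real) measure" +
  fixes n :: nat
  assumes sets_N [measurable_cong]: "sets N = sets (Rn n)"
    and rotate: "\<And>Q. orthogonal_entries n Q \<Longrightarrow> distr N (Rn n) (matvec n Q) = N"
    and no_atom: "measure N {y \<in> space N. \<forall>i\<in>{1..n}. y i = 0} = 0"
    and dim_ge_2: "n \<ge> 2"
begin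

lemma distr_rotate:
  assumes "orthogonal_entries n Q" "f \<in> borel_measurable (Rn n)"
  shows "distr N borel (\<lambda>y. f (matvec n Q y)) = distr N borel (f :: _ \<Rightarrow> real)"
proof -
  have [measurable]: "matvec n Q \<in> measurable N (Rn n)"
    by measurable
  have "distr N borel f = distr (distr N (Rn n) (matvec n Q)) borel f"
    by (simp only: rotate[OF assms(1)])
  also have "\<dots> = distr N borel (\<lambda>y. f (matvec n Q y))"
    by (subst distr_distr) (use assms in \<open>simp_all add: comp_def\<close>)
  finally show ?thesis by simp
qed

lemma prob_rotate:
  assumes Q: "orthogonal_entries n Q" and P: "Measurable.pred (Rn n) P"
  shows "prob {y \<in> space N. P (matvec n Q y)} = prob {y \<in> space N. P y}"
proof -
  have [measurable]: "matvec n Q \<in> measurable N (Rn n)"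
    by measurable
  have S: "{y \<in> space (Rn n). P y} \<in> sets (Rn n)"
    using P by measurable
  have sp: "space N = space (Rn n)"
    by (rule sets_eq_imp_space_eq[OF sets_N])
  have "prob {y \<in> space N. P y} = measure (distr N (Rn n) (matvec n Q)) {y \<in> space (Rn n). P y}"
    by (simp only: rotate[OF Q] sp)
  also have "\<dots> = prob (matvec n Q -` {y \<in> space (Rn n). P y} \<inter> space N)"
    using S by (simp add: measure_distr)
  also have "matvec n Q -` {y \<in> space (Rn n). P y} \<inter> space N = {y \<in> space N. P (matvec n Q y)}"
    by (auto simp: sp matvec_def space_PiM)
  finally show ?thesis by simp
qed

text \<open>
  Outside the origin, all lines through it carry the same mass, because they are images of each other
  under reflections. The lines spanned by \<open>e\<^sub>1 + k e\<^sub>2\<close> are disjoint outside the origin, so this common mass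
  is 0; one line is that of the constant vectors.
\<close>

lemma AE_not_constant: "AE y in N. \<not> (\<forall>i\<in>{1..n}. y i = mean n y)"
proof -
  define D where "D = {y \<in> space N. (\<forall>i\<in>{1..n}. y i = mean n y) \<and> \<not> (\<forall>i\<in>{1..n}. y i = 0)}"
  define E where "E = (\<lambda>k::nat. {y \<in> space N. y 1 \<noteq> 0 \<and> y 2 = real k * y 1})"
  have idx: "1 \<in> {1..n}" "2 \<in> {1..n}"
    using dim_ge_2 by auto
  have comp [measurable]: "(\<lambda>y. y i) \<in> borel_measurable (Rn n)" if "i \<in> {1..n}" for i
    using that by measurable
  have [measurable]: "(\<lambda>y. y 1) \<in> borel_measurable (Rn n)" "(\<lambda>y. y 2) \<in> borel_measurable (Rn n)"
    by (intro comp idx)+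
  have E_sets: "E k \<in> sets N" for k
    unfolding E_def by (intro sets.sets_Collect_conj sets.sets_Collect_neg) measurable
  have DE: "prob D \<le> prob (E k)" for k
  proof -
    \<comment> \<open>\<open>b\<close> points in direction \<open>e\<^sub>1 + k e\<^sub>2\<close> and is as long as the vector of ones.\<close>
    define s where "s = sqrt (real n) / sqrt (1 + (real k)\<^sup>2)"
    define b where "b = (\<lambda>i::nat. if i = 1 then s else if i = 2 then s * real k else 0)"
    have "1 + (real k)\<^sup>2 > 0"
      by (simp add: add_pos_nonneg)
    then have s: "s\<^sup>2 * (1 + (real k)\<^sup>2) = real n" "s \<noteq> 0"
      using dim_ge_2 by (auto simp: s_def power_divide)
    have "dot n b b = (\<Sum>i\<in>{1,2}. b i * b i)"
      unfolding dot_def using idx by (intro sum.mono_neutral_right) (auto simp: b_def)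
    also have "\<dots> = real n"
      using s by (simp add: b_def algebra_simps power2_eq_square)
    finally have norm_b: "dot n (\<lambda>_. 1) (\<lambda>_. 1) = dot n b b"
      by (simp add: dot_def)
    obtain Q where Q: "orthogonal_entries n Q"
      and Qb: "\<And>i. i \<in> {1..n} \<Longrightarrow> matvec n Q (\<lambda>_. 1) i = b i"
      using reflection_exists[OF norm_b] by blast
    have [measurable]: "(\<lambda>y. matvec n Q y 1) \<in> borel_measurable (Rn n)" "(\<lambda>y. matvec n Q y 2) \<in> borel_measurable (Rn n)"
      by (rule measurable_compose[OF matvec_measurable], measurable)+
    have "D \<subseteq> {y \<in> space N. matvec n Q y 1 \<noteq> 0 \<and> matvec n Q y 2 = real k * matvec n Q y 1}"
    proof
      fix y assume y: "y \<in> D"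
      define c where "c = mean n y"
      have yc: "y i = c" if "i \<in> {1..n}" for i
        using y that by (simp add: D_def c_def)
      have "c \<noteq> 0"
        using y yc by (auto simp: D_def)
      have "matvec n Q y i = c * b i" if i: "i \<in> {1..n}" for i
        using Qb[OF i] i yc by (simp add: matvec_nth flip: sum_distrib_right)
      then show "y \<in> {y \<in> space N. matvec n Q y 1 \<noteq> 0 \<and> matvec n Q y 2 = real k * matvec n Q y 1}"
        using y idx \<open>c \<noteq> 0\<close> s(2) by (simp add: D_def b_def)
    qed
    then have "prob D \<le> prob {y \<in> space N. matvec n Q y 1 \<noteq> 0 \<and> matvec n Q y 2 = real k * matvec n Q y 1}"
      by (intro finite_measure_mono sets.sets_Collect_conj sets.sets_Collect_neg) measurable
    also have "\<dots> = prob (E k)"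
      unfolding E_def
      by (intro prob_rotate[OF Q], unfold pred_def)
        (intro sets.sets_Collect_conj sets.sets_Collect_neg; measurable)
    finally show ?thesis .
  qed
  have "disjoint_family E"
    by (auto simp: disjoint_family_on_def E_def)
  then have "summable (\<lambda>k. prob (E k))"
    using E_sets finite_measure_UNION[of E] by (auto simp: sums_iff)
  then have "(\<lambda>k. prob (E k)) \<longlonglongrightarrow> 0"
    by (rule summable_LIMSEQ_zero)
  then have "prob D \<le> 0"
    by (rule LIMSEQ_le_const) (use DE in auto)
  then have D0: "prob D = 0"
    using measure_nonneg[of N D] by linarith
  have [measurable]: "D \<in> sets N" "{y \<in> space N. \<forall>i\<in>{1..n}. y i = 0} \<in> sets N"
    unfolding D_def
    by (intro sets.sets_Collect_conj sets.sets_Collect_neg sets.sets_Collect_finite_All finite_atLeastAtMost;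
        measurable)+
  have "AE y in N. y \<notin> D" "AE y in N. y \<notin> {y \<in> space N. \<forall>i\<in>{1..n}. y i = 0}"
    using D0 no_atom by (intro AE_not_in null_setsI; simp add: emeasure_eq_measure)+
  then show ?thesis
    by (auto simp: D_def)
qed

text \<open>
  The reflection that exchanges \<open>u\<close> and \<open>v\<close> fixes the vector of ones, which is orthogonal to both.
\<close>

lemma distr_dot_centered_dir:
  assumes "dot n u u = dot n v v" "dot n u (\<lambda>_. 1) = 0" "dot n v (\<lambda>_. 1) = 0"
  shows "distr N borel (\<lambda>y. dot n u (centered_dir n y)) = distr N borel (\<lambda>y. dot n v (centered_dir n y))"
proof -
  obtain Q where Q: "orthogonal_entries n Q" "\<And>i. i \<in> {1..n} \<Longrightarrow> matvec n Q u i = v i"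
    and Qx: "\<And>x i. i \<in> {1..n} \<Longrightarrow> dot n u x = dot n v x \<Longrightarrow> matvec n Q x i = x i"
    using reflection_exists[OF assms(1)] by blast
  then have one: "\<And>i. i \<in> {1..n} \<Longrightarrow> matvec n Q (\<lambda>_. 1) i = 1"
    using assms(2,3) by (intro Qx) simp_all
  have "dot n v (centered_dir n (matvec n Q y)) = dot n (matvec n Q u) (matvec n Q (centered_dir n y))" for y
    by (rule dot_cong) (simp_all only: Q(2) centered_dir_matvec[OF Q(1) one])
  then have "dot n v (centered_dir n (matvec n Q y)) = dot n u (centered_dir n y)" for y
    by (simp add: dot_matvec[OF Q(1)])
  then show ?thesis
    using distr_rotate[OF Q(1), of "\<lambda>y. dot n v (centered_dir n y)"] by simp
qed

text \<open>
  One fixed unit vector orthogonal to the ones; by the preceding lemma it represents all of them.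
\<close>

definition axis :: "nat \<Rightarrow> real" where
  "axis i = (if i = 1 then 1 / sqrt 2 else if i = 2 then - 1 / sqrt 2 else 0)"

lemma dot_axis: "dot n axis x = (x 1 - x 2) / sqrt 2"
proof -
  have "dot n axis x = (\<Sum>i\<in>{1,2}. axis i * x i)"
    unfolding dot_def using dim_ge_2 by (intro sum.mono_neutral_right) (auto simp: axis_def)
  then show ?thesis
    by (simp add: axis_def field_simps)
qed

lemma axis_unit: "dot n axis axis = 1" "dot n axis (\<lambda>_. 1) = 0"
  by (simp_all add: dot_axis) (simp add: axis_def field_simps)

definition moment :: "nat \<Rightarrow> real" where
  "moment j = expectation (\<lambda>y. dot n axis (centered_dir n y) ^ j)"

lemma expectation_dot_power:
  assumes "dot n a (\<lambda>_. 1) = 0"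
  shows "expectation (\<lambda>y. dot n a (centered_dir n y) ^ j) = sqrt (dot n a a) ^ j * moment j"
proof -
  let ?b = "\<lambda>i. sqrt (dot n a a) * axis i"
  have "distr N borel (\<lambda>y. dot n a (centered_dir n y)) = distr N borel (\<lambda>y. dot n ?b (centered_dir n y))"
    using assms by (intro distr_dot_centered_dir) (simp_all add: dot_linear axis_unit dot_self_nonneg)
  then have "(\<integral>r. r ^ j \<partial>distr N borel (\<lambda>y. dot n a (centered_dir n y))) =
      (\<integral>r. r ^ j \<partial>distr N borel (\<lambda>y. dot n ?b (centered_dir n y)))"
    by simp
  then show ?thesis
    by (simp add: integral_distr dot_linear power_mult_distrib moment_def)
qed

lemma moment_odd: "odd j \<Longrightarrow> moment j = 0"
proof -
  assume j: "odd j"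
  let ?a = "\<lambda>i. (-1) * axis i"
  have "expectation (\<lambda>y. dot n ?a (centered_dir n y) ^ j) = sqrt (dot n ?a ?a) ^ j * moment j"
    by (rule expectation_dot_power) (simp only: dot_scale_left axis_unit)
  then have "- moment j = moment j"
    using j by (simp only: dot_scale_left dot_scale_right axis_unit) (simp add: moment_def)
  then show ?thesis by simp
qed

lemma moment_0: "moment 0 = 1"
  by (simp add: moment_def prob_space)

lemma integrable_bounded_poly:
  assumes "f \<in> borel_measurable N" "\<And>y. \<bar>f y\<bar> \<le> c"
  shows "integrable N (f :: _ \<Rightarrow> real)"
  using assms by (intro integrable_const_bound[of _ c]) auto

lemma integrable_dot_powers:
  "integrable N (\<lambda>y. dot n a (centered_dir n y) ^ i * dot n b (centered_dir n y) ^ j)"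
proof (rule integrable_bounded_poly)
  have *: "\<bar>dot n a (centered_dir n y)\<bar> \<le> sqrt (dot n a a)" for a y
    using dot_Cauchy_Schwarz[of n a "centered_dir n y"]
    by (rule order_trans) (auto simp: dot_centered_dir_self dot_self_nonneg)
  show "\<bar>dot n a (centered_dir n y) ^ i * dot n b (centered_dir n y) ^ j\<bar>
      \<le> sqrt (dot n a a) ^ i * sqrt (dot n b b) ^ j" for y
    unfolding abs_mult power_abs
    by (intro mult_mono power_mono *) (simp_all add: dot_self_nonneg)
qed measurable

text \<open>
  Both sides are the coefficient of \<open>\<tau>\<^sup>2\<close> in \<open>E \<langle>axis + \<tau> w, V\<rangle>\<^sup>2\<^sup>k\<close>: on the left after expanding the power
  inside the expectation, on the right after extracting the length of \<open>axis + \<tau> w\<close> by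
  \<open>expectation_dot_power\<close>.
\<close>

lemma mixed_moment:
  assumes k: "k \<ge> 1" and w: "dot n w (\<lambda>_. 1) = 0"
  shows "real (2 * k choose 2) *
      expectation (\<lambda>y. dot n axis (centered_dir n y) ^ (2 * k - 2) * dot n w (centered_dir n y) ^ 2) =
    moment (2 * k) * (real k * dot n w w + 2 * real k * (real k - 1) * (dot n axis w)\<^sup>2)"
proof -
  let ?A = "\<lambda>y. dot n axis (centered_dir n y)" and ?B = "\<lambda>y. dot n w (centered_dir n y)"
  let ?c = "\<lambda>i. real (2 * k choose i) * expectation (\<lambda>y. ?A y ^ (2 * k - i) * ?B y ^ i)"
  define P where "P = (\<Sum>i\<le>2 * k. monom (?c i) i)"
  define R where "R = smult (moment (2 * k)) ([:1, 2 * dot n axis w, dot n w w:] ^ k)"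
  have "poly P \<tau> = poly R \<tau>" for \<tau>
  proof -
    let ?a = "\<lambda>i. axis i + \<tau> * w i"
    have "(?A y + \<tau> * ?B y) ^ (2 * k) =
        (\<Sum>i\<le>2 * k. (real (2 * k choose i) * \<tau> ^ i) * (?A y ^ (2 * k - i) * ?B y ^ i))" for y
      unfolding add.commute[of "?A y"]
      by (subst binomial_ring) (simp add: power_mult_distrib algebra_simps)
    then have "expectation (\<lambda>y. (?A y + \<tau> * ?B y) ^ (2 * k)) = (\<Sum>i\<le>2 * k. ?c i * \<tau> ^ i)"
      by (simp add: integrable_dot_powers algebra_simps)
    also have "\<dots> = poly P \<tau>"
      by (simp add: P_def poly_sum poly_monom)
    finally have "poly P \<tau> = expectation (\<lambda>y. dot n ?a (centered_dir n y) ^ (2 * k))"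
      by (simp add: dot_linear)
    also have "\<dots> = sqrt (dot n ?a ?a) ^ (2 * k) * moment (2 * k)"
      using w by (intro expectation_dot_power) (simp add: dot_linear axis_unit)
    also have "sqrt (dot n ?a ?a) ^ (2 * k) = (1 + \<tau> * (2 * dot n axis w + \<tau> * dot n w w)) ^ k"
    proof -
      have "dot n ?a ?a = 1 + \<tau> * (2 * dot n axis w + \<tau> * dot n w w)"
        by (simp add: dot_linear axis_unit dot_commute[of n w axis] algebra_simps)
      then show ?thesis
        using dot_self_nonneg[of n ?a] by (simp add: power_mult)
    qed
    finally show ?thesis
      by (simp add: R_def)
  qed
  then have "P = R"
    by (auto simp: poly_eq_poly_eq_iff[symmetric])
  then have "coeff P 2 = coeff R 2"
    by simp
  moreover have "coeff P 2 = ?c 2"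
    using k by (simp add: P_def coeff_sum)
  moreover have "coeff R 2 =
      moment (2 * k) * (real k * dot n w w + (2 * dot n axis w)\<^sup>2 * real k * (real k - 1) / 2)"
    using coeff_quadratic_power[of "2 * dot n axis w" "dot n w w" k] by (simp add: R_def)
  ultimately show ?thesis
    by (simp add: power_mult_distrib field_simps)
qed

text \<open>
  Sum of \<open>mixed_moment\<close> over the centred coordinate vectors \<open>w\<close>: the numbers \<open>\<langle>w, V\<rangle>\<close> are then the
  coordinates of \<open>V\<close>, whose squares add up to 1.
\<close>

lemma moment_recurrence: "(2 * real l + 1) * moment (2 * l) = (real n + 2 * real l - 1) * moment (2 * l + 2)"
proof -
  define k where "k = Suc l"
  \<comment> \<open>\<open>w i\<close> is the \<open>i\<close>-th coordinate vector minus its mean.\<close>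
  define w where "w = (\<lambda>i j::nat. (if j = i then 1 else 0) - 1 / real n)"
  let ?V = "centered_dir n"
  have n1: "n \<ge> 1" "n > 0" using dim_ge_2 by auto
  have dw: "dot n (w i) x = x i - dot n (\<lambda>_. 1) x / real n" if "i \<in> {1..n}" for i x
  proof -
    have "dot n (w i) x = (\<Sum>j=1..n. (if i = j then x j else 0) - x j / real n)"
      unfolding dot_def by (intro sum.cong) (auto simp: w_def left_diff_distrib)
    then show ?thesis
      using that by (simp add: sum_subtractf dot_def sum_divide_distrib)
  qed
  have d11: "dot n (\<lambda>_. 1) (\<lambda>_. 1) = real n"
    by (simp add: dot_def)
  have w1: "dot n (w i) (\<lambda>_. 1) = 0" if "i \<in> {1..n}" for i
    using n1 by (simp add: dw[OF that] d11)
  have wV: "dot n (w i) (?V y) = ?V y i" if "i \<in> {1..n}" for i y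
    using n1 by (simp add: dw[OF that] dot_one_centered_dir)
  have ww: "dot n (w i) (w i) = 1 - 1 / real n" if "i \<in> {1..n}" for i
    using w1[OF that] by (subst dw[OF that]) (simp add: dot_commute[of n "\<lambda>_. 1"] w_def)
  have aw: "dot n axis (w i) = axis i" if "i \<in> {1..n}" for i
    using axis_unit(2) by (simp add: dot_commute[of n axis] dw[OF that])
  have eq: "real (2 * k choose 2) *
      expectation (\<lambda>y. dot n axis (?V y) ^ (2 * l) * (dot n (w i) (?V y))\<^sup>2) =
    moment (2 * k) * (real k * (1 - 1 / real n) + 2 * real k * (real k - 1) * (axis i)\<^sup>2)"
    if i: "i \<in> {1..n}" for i
    using mixed_moment[of k "w i"] w1[OF i] by (simp add: ww[OF i] aw[OF i] k_def)
  have "real (2 * k choose 2) *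
      (\<Sum>i=1..n. expectation (\<lambda>y. dot n axis (?V y) ^ (2 * l) * (dot n (w i) (?V y))\<^sup>2)) =
    (\<Sum>i=1..n. moment (2 * k) * (real k * (1 - 1 / real n) + 2 * real k * (real k - 1) * (axis i)\<^sup>2))"
    unfolding sum_distrib_left by (intro sum.cong eq refl)
  also have "\<dots> = moment (2 * k) * (real k * (real n - 1) + 2 * real k * (real k - 1))"
  proof -
    have "(\<Sum>i=1..n. (axis i)\<^sup>2) = 1"
      using axis_unit(1) by (simp only: sum_power2_eq_dot)
    moreover have "real n * (1 - 1 / real n) = real n - 1"
      using n1 by (simp add: field_simps)
    moreover have "(\<Sum>i=1..n. x * (y * z + t * (axis i)\<^sup>2)) =
        x * (y * (real n * z) + t * (\<Sum>i=1..n. (axis i)\<^sup>2))" for x y z t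
      by (simp add: sum.distrib algebra_simps flip: sum_distrib_left)
    ultimately show ?thesis
      by simp
  qed
  also have "(\<Sum>i=1..n. expectation (\<lambda>y. dot n axis (?V y) ^ (2 * l) * (dot n (w i) (?V y))\<^sup>2)) =
      expectation (\<lambda>y. \<Sum>i=1..n. dot n axis (?V y) ^ (2 * l) * (dot n (w i) (?V y))\<^sup>2)"
    by (rule Bochner_Integration.integral_sum[symmetric]) (rule integrable_dot_powers)
  also have "\<dots> = expectation (\<lambda>y. dot n axis (?V y) ^ (2 * l))"
  proof (rule integral_cong_AE)
    show "AE y in N. (\<Sum>i=1..n. dot n axis (?V y) ^ (2 * l) * (dot n (w i) (?V y))\<^sup>2)
        = dot n axis (?V y) ^ (2 * l)"
      using AE_not_constant
    proof eventually_elim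
      case (elim y)
      have "(\<Sum>i=1..n. (dot n (w i) (?V y))\<^sup>2) = (\<Sum>i=1..n. (?V y i)\<^sup>2)"
        by (intro sum.cong refl) (simp add: wV)
      also have "\<dots> = 1"
        using elim by (simp only: sum_power2_eq_dot dot_centered_dir_self if_False)
      finally show ?case
        by (simp flip: sum_distrib_left)
    qed
  qed measurable
  also have "\<dots> = moment (2 * l)"
    by (simp add: moment_def)
  finally have "real (2 * k choose 2) * moment (2 * l) =
      moment (2 * k) * (real k * (real n - 1) + 2 * real k * (real k - 1))" .
  moreover have "real (2 * k choose 2) = real k * (2 * real k - 1)"
  proof -
    have "2 * k choose 2 = k * (2 * k - 1)"
      by (simp add: choose_two)
    then show ?thesis
      by (simp add: k_def algebra_simps)
  qed
  ultimately have "real k * ((2 * real k - 1) * moment (2 * l)) =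
      real k * (moment (2 * k) * (real n - 1 + 2 * (real k - 1)))"
    by (simp only:) (simp add: algebra_simps)
  then have "(2 * real k - 1) * moment (2 * l) = moment (2 * k) * (real n - 1 + 2 * (real k - 1))"
    by (simp add: k_def)
  then show ?thesis
    by (simp add: k_def algebra_simps)
qed

end

section \<open>The law of the correlation coefficient\<close>

text \<open>
  Asking for derivatives only in the interior matters: \<open>arcsin\<close> and \<open>\<lambda>r. sqrt (1 - r\<^sup>2)\<close> have none at
  the endpoint 1.
\<close>

lemma has_integral_by_interior_derivative:
  fixes F f :: "real \<Rightarrow> real"
  assumes "a \<le> b" "continuous_on {a..b} F" "\<And>x. a < x \<Longrightarrow> x < b \<Longrightarrow> (F has_real_derivative f x) (at x)"
  shows "(f has_integral (F b - F a)) {a..b}"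
  using assms by (intro fundamental_theorem_of_calculus_interior)
    (auto simp: has_real_derivative_iff_has_vector_derivative)

text \<open>
  Up to normalisation, the density of the correlation coefficient in dimension \<open>n = d + 4\<close>, that is,
  \<open>(1 - r\<^sup>2)\<^bsup>d / 2\<^esup>\<close>. The power of a square root allows odd \<open>d\<close> with a natural exponent.
\<close>

definition corr_weight :: "nat \<Rightarrow> real \<Rightarrow> real" where
  "corr_weight d r = sqrt (1 - r\<^sup>2) ^ d"

definition corr_mass :: "nat \<Rightarrow> real" where
  "corr_mass d = integral {0..1} (corr_weight d)"

lemma continuous_corr_weight [continuous_intros]: "continuous_on A (corr_weight d)"
  unfolding corr_weight_def[abs_def] by (intro continuous_intros)

lemma corr_weight_measurable [measurable]: "corr_weight d \<in> borel_measurable borel"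
  by (rule borel_measurable_continuous_onI) (rule continuous_corr_weight)

lemma corr_weight_nonneg: "\<bar>r\<bar> \<le> 1 \<Longrightarrow> corr_weight d r \<ge> 0"
  by (simp add: corr_weight_def abs_square_le_1)

lemma one_minus_square_pos: "\<bar>r::real\<bar> < 1 \<Longrightarrow> 1 - r\<^sup>2 > 0"
  by (simp add: abs_square_less_1)

lemma corr_weight_minus: "corr_weight d (- r) = corr_weight d r"
  by (simp add: corr_weight_def)

lemma corr_weight_add_2: "\<bar>r\<bar> \<le> 1 \<Longrightarrow> corr_weight (d + 2) r = corr_weight d r * (1 - r\<^sup>2)"
  by (simp add: corr_weight_def power_add abs_square_le_1)

lemma corr_weight_derivative:
  assumes "\<bar>r\<bar> < 1"
  shows "(corr_weight (d + 2) has_real_derivative - real (d + 2) * r * corr_weight d r) (at r)"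
proof -
  have pos: "1 - r\<^sup>2 > 0"
    by (rule one_minus_square_pos) fact
  have "((\<lambda>r. 1 - r\<^sup>2) has_real_derivative - 2 * r) (at r)"
    by (auto intro!: derivative_eq_intros)
  from DERIV_power[OF DERIV_chain2[OF DERIV_real_sqrt[OF pos] this], of "d + 2"]
  show ?thesis
    using pos by (simp add: corr_weight_def[abs_def] field_simps)
qed

lemma corr_mass_pos: "corr_mass d > 0"
proof -
  have "corr_mass d \<ge> 0"
    unfolding corr_mass_def by (rule integral_nonneg)
      (auto intro!: integrable_continuous_interval continuous_intros corr_weight_nonneg)
  moreover have "corr_mass d \<noteq> 0"
  proof
    assume "corr_mass d = 0"
    then have "(corr_weight d has_integral 0) {0..1}"
      using integrable_continuous_interval[OF continuous_corr_weight[of "{0..1}" d]]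
      by (simp add: corr_mass_def has_integral_iff)
    then have "corr_weight d 0 = 0"
      by (rule has_integral_0_cbox_imp_0[of 0 1 "corr_weight d" 0, unfolded box_real, rotated 2])
         (auto intro!: continuous_intros corr_weight_nonneg)
    then show False
      by (simp add: corr_weight_def)
  qed
  ultimately show ?thesis by simp
qed

lemma has_integral_corr_weight_symmetric: "(corr_weight d has_integral 2 * corr_mass d) {-1..1}"
proof -
  have "(corr_weight d has_integral corr_mass d) {0..1}"
    unfolding corr_mass_def
    by (intro integrable_integral integrable_continuous_interval continuous_intros)
  moreover from this have "((\<lambda>r. corr_weight d (- r)) has_integral corr_mass d) {- 1.. - 0}"
    by (subst has_integral_reflect_real) simp_all
  ultimately have "(corr_weight d has_integral corr_mass d + corr_mass d) {-1..1}"
    by (intro has_integral_combine[of "-1" 0 1]) (simp_all add: corr_weight_minus)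
  then show ?thesis by simp
qed

definition corr_law :: "nat \<Rightarrow> real measure" where
  "corr_law d = density lborel (\<lambda>r. ennreal (indicator {-1..1} r * corr_weight d r / (2 * corr_mass d)))"

lemma sets_corr_law [simp, measurable_cong]: "sets (corr_law d) = sets borel"
  by (simp add: corr_law_def)

lemma space_corr_law [simp]: "space (corr_law d) = UNIV"
  by (simp add: corr_law_def)

lemma corr_density_nonneg: "indicator {-1..1} r * corr_weight d r / (2 * corr_mass d) \<ge> 0"
  using corr_mass_pos[of d] corr_weight_nonneg[of r d] by (auto simp: indicator_def)

lemma has_bochner_integral_corr_law:
  fixes f :: "real \<Rightarrow> real"
  assumes f [measurable]: "f \<in> borel_measurable borel"
    and cont: "continuous_on {a..b} f" and ab: "-1 \<le> a" "b \<le> 1"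
    and I: "((\<lambda>r. f r * corr_weight d r) has_integral I) {a..b}"
  shows "has_bochner_integral (corr_law d) (\<lambda>r. indicator {a..b} r * f r) (I / (2 * corr_mass d))"
proof -
  have si: "set_integrable lborel {a..b} (\<lambda>r. f r * corr_weight d r)"
    by (intro borel_integrable_atLeastAtMost' continuous_intros cont)
  have "has_bochner_integral lborel (\<lambda>r. indicator {a..b} r *\<^sub>R (f r * corr_weight d r)) I"
    using si set_borel_integral_eq_integral(2)[OF si] I
    by (simp add: has_bochner_integral_iff set_integrable_def set_lebesgue_integral_def integral_unique)
  then have "has_bochner_integral lborel
      (\<lambda>r. (1 / (2 * corr_mass d)) * (indicator {a..b} r *\<^sub>R (f r * corr_weight d r))) ((1 / (2 * corr_mass d)) * I)"
    by (rule has_bochner_integral_mult_right)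
  moreover have "(1 / (2 * corr_mass d)) * (indicator {a..b} r *\<^sub>R (f r * corr_weight d r)) =
      (indicator {-1..1} r * corr_weight d r / (2 * corr_mass d)) *\<^sub>R (indicator {a..b} r * f r)" for r
    using ab by (auto simp: indicator_def)
  ultimately have "has_bochner_integral lborel
      (\<lambda>r. (indicator {-1..1} r * corr_weight d r / (2 * corr_mass d)) *\<^sub>R (indicator {a..b} r * f r))
      (I / (2 * corr_mass d))"
    by (simp only: times_divide_eq_left mult_1_left)
  then show ?thesis
    unfolding corr_law_def
    by (intro has_bochner_integral_density) (auto simp: corr_density_nonneg)
qed

lemma prob_space_corr_law: "prob_space (corr_law d)"
proof
  have "has_bochner_integral lborel (\<lambda>r. indicator {-1..1} r *\<^sub>R corr_weight d r) (2 * corr_mass d)"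
  proof -
    have si: "set_integrable lborel {-1..1} (corr_weight d)"
      by (intro borel_integrable_atLeastAtMost' continuous_intros)
    show ?thesis
      using si set_borel_integral_eq_integral(2)[OF si] has_integral_corr_weight_symmetric[of d]
      by (simp add: has_bochner_integral_iff set_integrable_def set_lebesgue_integral_def integral_unique)
  qed
  then have "has_bochner_integral lborel
      (\<lambda>r. (1 / (2 * corr_mass d)) * (indicator {-1..1} r *\<^sub>R corr_weight d r)) ((1 / (2 * corr_mass d)) * (2 * corr_mass d))"
    by (rule has_bochner_integral_mult_right)
  then have *: "has_bochner_integral lborel
      (\<lambda>r. indicator {-1..1} r * corr_weight d r / (2 * corr_mass d)) 1"
    using corr_mass_pos[of d] by simp
  have "(\<integral>\<^sup>+ r. ennreal (indicator {-1..1} r * corr_weight d r / (2 * corr_mass d)) \<partial>lborel) = ennreal 1"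
    by (rule trans[OF nn_integral_eq_integral[OF integrable.intros[OF *]]])
      (rule AE_I2, rule corr_density_nonneg, rule arg_cong[OF has_bochner_integral_integral_eq[OF *]])
  then show "emeasure (corr_law d) (space (corr_law d)) = 1"
    by (simp add: corr_law_def emeasure_density)
qed

interpretation corr_law: prob_space "corr_law d" for d
  by (rule prob_space_corr_law)

lemma real_distribution_corr_law: "real_distribution (corr_law d)"
  by (intro real_distribution.intro real_distribution_axioms.intro prob_space_corr_law) simp_all

lemma AE_corr_law_bounded: "AE r in corr_law d. \<bar>r\<bar> \<le> 1"
  unfolding corr_law_def by (subst AE_density) (auto simp: indicator_def)

lemma corr_law_integral_eq_Icc:
  fixes f :: "real \<Rightarrow> real"
  assumes "f \<in> borel_measurable borel"
  shows "(\<integral>r. f r \<partial>corr_law d) = (\<integral>r. indicator {-1..1} r * f r \<partial>corr_law d)"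
  using AE_corr_law_bounded[of d] assms by (intro integral_cong_AE) (auto simp: indicator_def)

lemma corr_law_moment:
  assumes I: "((\<lambda>r. r ^ j * corr_weight d r) has_integral I) {-1..1}"
  shows "(\<integral>r. r ^ j \<partial>corr_law d) = I / (2 * corr_mass d)"
proof -
  have "(\<integral>r. r ^ j \<partial>corr_law d) = (\<integral>r. indicator {-1..1} r * r ^ j \<partial>corr_law d)"
    by (rule corr_law_integral_eq_Icc) measurable
  also have "\<dots> = I / (2 * corr_mass d)"
    by (rule has_bochner_integral_integral_eq, rule has_bochner_integral_corr_law)
       (use I in \<open>auto intro!: continuous_intros\<close>)
  finally show ?thesis .
qed

lemma has_integral_corr_moment:
  "((\<lambda>r. r ^ j * corr_weight d r) has_integral 2 * corr_mass d * (\<integral>r. r ^ j \<partial>corr_law d)) {-1..1}"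
proof -
  have "(\<lambda>r. r ^ j * corr_weight d r) integrable_on {-1..1}"
    by (intro integrable_continuous_interval continuous_intros)
  then obtain I where I: "((\<lambda>r. r ^ j * corr_weight d r) has_integral I) {-1..1}"
    by (auto simp: integrable_on_def)
  then show ?thesis
    using corr_law_moment[OF I] corr_mass_pos[of d] by simp
qed

text \<open>
  Integrate the derivative of \<open>r\<^bsup>j + 1\<^esup> (1 - r\<^sup>2)\<^bsup>(d + 2) / 2\<^esup>\<close>, which vanishes at both endpoints. For
  \<open>d = n - 4\<close> and even \<open>j\<close> this is the recurrence of \<open>moment_recurrence\<close>.
\<close>

lemma corr_law_moment_recurrence:
  "(real j + 1) * (\<integral>r. r ^ j \<partial>corr_law d) = (real j + real d + 3) * (\<integral>r. r ^ (j + 2) \<partial>corr_law d)"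
proof -
  let ?m = "\<lambda>j. \<integral>r. r ^ j \<partial>corr_law d"
  have "((\<lambda>r. (real j + 1) * (r ^ j * corr_weight d r) - (real j + real d + 3) * (r ^ (j + 2) * corr_weight d r))
      has_integral (1 ^ (j + 1) * corr_weight (d + 2) 1 - (-1) ^ (j + 1) * corr_weight (d + 2) (-1))) {-1..1}"
  proof (rule has_integral_by_interior_derivative)
    fix r :: real assume "-1 < r" "r < 1"
    then have r: "\<bar>r\<bar> < 1" by simp
    have "((\<lambda>r. r ^ (j + 1) * corr_weight (d + 2) r) has_real_derivative
        (real j + 1) * r ^ j * corr_weight (d + 2) r + r ^ (j + 1) * (- real (d + 2) * r * corr_weight d r)) (at r)"
      by (rule derivative_eq_intros corr_weight_derivative[OF r] refl)+ (simp add: algebra_simps)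
    also have "(real j + 1) * r ^ j * corr_weight (d + 2) r + r ^ (j + 1) * (- real (d + 2) * r * corr_weight d r)
        = (real j + 1) * (r ^ j * corr_weight d r) - (real j + real d + 3) * (r ^ (j + 2) * corr_weight d r)"
      using r by (subst corr_weight_add_2) (simp_all add: algebra_simps power2_eq_square power_add)
    finally show "((\<lambda>r. r ^ (j + 1) * corr_weight (d + 2) r) has_real_derivative
        (real j + 1) * (r ^ j * corr_weight d r) - (real j + real d + 3) * (r ^ (j + 2) * corr_weight d r)) (at r)" .
  qed (auto intro!: continuous_intros)
  then have "((\<lambda>r. (real j + 1) * (r ^ j * corr_weight d r) - (real j + real d + 3) * (r ^ (j + 2) * corr_weight d r))
      has_integral 0) {-1..1}"
    by (simp add: corr_weight_def)
  from has_integral_unique[OF _ this]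
  have "(real j + 1) * (2 * corr_mass d * ?m j) - (real j + real d + 3) * (2 * corr_mass d * ?m (j + 2)) = 0"
    by this (intro has_integral_diff has_integral_mult_right has_integral_corr_moment)
  then have "2 * corr_mass d * ((real j + 1) * ?m j - (real j + real d + 3) * ?m (j + 2)) = 0"
    by (simp add: algebra_simps)
  then show ?thesis
    using corr_mass_pos[of d] by simp
qed

lemma corr_law_moment_1: "(\<integral>r. r ^ 1 \<partial>corr_law d) = 0"
proof -
  have "((\<lambda>r. r ^ 1 * corr_weight d r) has_integral
      (- corr_weight (d + 2) 1 / real (d + 2) - - corr_weight (d + 2) (-1) / real (d + 2))) {-1..1}"
  proof (rule has_integral_by_interior_derivative)
    fix r :: real assume "-1 < r" "r < 1"
    then have "\<bar>r\<bar> < 1" by simp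
    show "((\<lambda>r. - corr_weight (d + 2) r / real (d + 2)) has_real_derivative r ^ 1 * corr_weight d r) (at r)"
      by (rule DERIV_cong[OF DERIV_cdivide[OF DERIV_minus[OF corr_weight_derivative[OF \<open>\<bar>r\<bar> < 1\<close>]]]])
        (simp add: field_simps)
  qed (auto intro!: continuous_intros)
  then have "((\<lambda>r. r ^ 1 * corr_weight d r) has_integral 0) {-1..1}"
    by (simp add: corr_weight_def)
  then show ?thesis
    using corr_law_moment[of 1 d 0] by simp
qed

lemma corr_law_moment_odd: "(\<integral>r. r ^ (2 * l + 1) \<partial>corr_law d) = 0"
proof (induction l)
  case 0
  show ?case using corr_law_moment_1[of d] by simp
next
  case (Suc l)
  have "(real (2 * l + 1) + real d + 3) * (\<integral>r. r ^ (2 * l + 1 + 2) \<partial>corr_law d) =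
      (real (2 * l + 1) + 1) * (\<integral>r. r ^ (2 * l + 1) \<partial>corr_law d)"
    by (rule corr_law_moment_recurrence[symmetric])
  also have "\<dots> = 0"
    unfolding Suc by (rule mult_zero_right)
  finally have "(\<integral>r. r ^ (2 * l + 1 + 2) \<partial>corr_law d) = 0"
    unfolding mult_eq_0_iff by linarith
  moreover have "2 * Suc l + 1 = 2 * l + 1 + 2"
    by simp
  ultimately show ?case
    by (simp only:)
qed

text \<open>
  For a law on \<open>[-1, 1]\<close> the Taylor polynomials of the characteristic function, which are determined by the
  moments, converge to it.
\<close>

lemma bounded_laws_eqI_moments:
  assumes M: "real_distribution M" "AE x in M. \<bar>x\<bar> \<le> 1"
    and M': "real_distribution M'" "AE x in M'. \<bar>x\<bar> \<le> 1"
    and eq: "\<And>j. (\<integral>x. x ^ j \<partial>M) = (\<integral>x. x ^ j \<partial>M')"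
  shows "M = M'"
proof (rule Levy_uniqueness[OF M(1) M'(1)], rule ext)
  fix t
  have lim: "(\<lambda>m. \<Sum>k\<le>m. ((\<i> * t) ^ k / fact k) * (\<integral>x. x ^ k \<partial>L)) \<longlonglongrightarrow> char L t"
    if L: "real_distribution L" "AE x in L. \<bar>x\<bar> \<le> 1" for L
  proof -
    interpret L: real_distribution L by fact
    have int: "integrable L (\<lambda>x. x ^ k)" for k
      using L(2) by (intro L.integrable_const_bound[of _ 1])
        (auto elim!: eventually_mono simp: power_abs power_le_one)
    have bound: "norm ((\<Sum>k\<le>m. ((\<i> * t) ^ k / fact k) * (\<integral>x. x ^ k \<partial>L)) - char L t) \<le> 2 * (\<bar>t\<bar> ^ m / fact m)" for m
    proof -
      have "L.expectation (\<lambda>x. \<bar>x\<bar> ^ m) \<le> L.expectation (\<lambda>x. 1)"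
      proof (rule integral_mono_AE)
        show "integrable L (\<lambda>x. \<bar>x\<bar> ^ m)"
          using int[of m] by (simp add: integrable_abs flip: power_abs)
        show "AE x in L. \<bar>x\<bar> ^ m \<le> 1"
          using L(2) by eventually_elim (simp add: power_le_one)
      qed simp
      then have "(2 * \<bar>t\<bar> ^ m / fact m) * L.expectation (\<lambda>x. \<bar>x\<bar> ^ m) \<le> (2 * \<bar>t\<bar> ^ m / fact m) * 1"
        using L.prob_space by (intro mult_left_mono) simp_all
      then show ?thesis
        using L.char_approx1[of m t] int by (simp add: norm_minus_commute)
    qed
    have "(\<lambda>m. \<bar>t\<bar> ^ m / fact m) \<longlonglongrightarrow> 0"
      using summable_LIMSEQ_zero[OF summable_exp[of "\<bar>t\<bar>"]] by (simp add: divide_inverse mult.commute)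
    then have "(\<lambda>m. 2 * (\<bar>t\<bar> ^ m / fact m)) \<longlonglongrightarrow> 0"
      by (rule tendsto_mult_right_zero)
    then have "(\<lambda>m. (\<Sum>k\<le>m. ((\<i> * t) ^ k / fact k) * (\<integral>x. x ^ k \<partial>L)) - char L t) \<longlonglongrightarrow> 0"
      by (rule Lim_null_comparison[rotated]) (use bound in auto)
    then show ?thesis
      by (rule LIM_zero_cancel)
  qed
  show "char M t = char M' t"
    using lim[OF M] lim[OF M'] unfolding eq by (rule LIMSEQ_unique)
qed

context spherical_law
begin

text \<open>
  Both laws live on \<open>[-1, 1]\<close>, have vanishing odd moments and satisfy the same recurrence for the even
  ones.
\<close>

lemma distr_dot_centered_dir_eq_corr_law:
  assumes n: "n \<ge> 4" and u: "dot n u u = 1" "dot n u (\<lambda>_. 1) = 0"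
  shows "distr N borel (\<lambda>y. dot n u (centered_dir n y)) = corr_law (n - 4)"
proof -
  have "distr N borel (\<lambda>y. dot n axis (centered_dir n y)) = corr_law (n - 4)"
  proof (rule bounded_laws_eqI_moments)
    show "real_distribution (distr N borel (\<lambda>y. dot n axis (centered_dir n y)))"
      by (rule real_distribution_distr) measurable
    show "AE x in distr N borel (\<lambda>y. dot n axis (centered_dir n y)). \<bar>x\<bar> \<le> 1"
      by (subst AE_distr_iff) (auto intro!: abs_dot_centered_dir_le_1 simp: axis_unit)
    have even: "moment (2 * l) = (\<integral>r. r ^ (2 * l) \<partial>corr_law (n - 4))" for l
    proof (induction l)
      case 0
      show ?case using corr_law.prob_space[of "n - 4"] by (simp add: moment_0)
    next
      case (Suc l)
      have "(real n + 2 * real l - 1) * moment (2 * l + 2) =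
          (real n + 2 * real l - 1) * (\<integral>r. r ^ (2 * l + 2) \<partial>corr_law (n - 4))"
        using moment_recurrence[of l] corr_law_moment_recurrence[of "2 * l" "n - 4"] Suc n
        by (simp add: of_nat_diff algebra_simps)
      moreover have "real n + 2 * real l - 1 > 0"
        using n by linarith
      ultimately show ?case
        by simp
    qed
    fix j
    have "(\<integral>x. x ^ j \<partial>distr N borel (\<lambda>y. dot n axis (centered_dir n y))) = moment j"
      by (simp add: integral_distr moment_def)
    also have "\<dots> = (\<integral>x. x ^ j \<partial>corr_law (n - 4))"
    proof (cases "even j")
      case True
      then show ?thesis using even by (auto elim!: evenE)
    next
      case False
      then show ?thesis
        using corr_law_moment_odd[of "n - 4"] by (auto simp: moment_odd elim!: oddE)
    qed
    finally show "(\<integral>x. x ^ j \<partial>distr N borel (\<lambda>y. dot n axis (centered_dir n y))) =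
        (\<integral>x. x ^ j \<partial>corr_law (n - 4))" .
  qed (rule real_distribution_corr_law AE_corr_law_bounded)+
  moreover have "distr N borel (\<lambda>y. dot n u (centered_dir n y)) = distr N borel (\<lambda>y. dot n axis (centered_dir n y))"
    using u by (intro distr_dot_centered_dir) (simp_all add: axis_unit)
  ultimately show ?thesis by simp
qed

end


definition corr_tail :: "nat \<Rightarrow> real \<Rightarrow> real" where
  "corr_tail d t = measure (corr_law d) {r. \<bar>r\<bar> \<ge> t}"

lemma corr_tail_eq:
  assumes t: "0 < t" "t \<le> 1"
  shows "corr_tail d t = integral {t..1} (corr_weight d) / corr_mass d"
proof -
  let ?I = "integral {t..1} (corr_weight d)"
  have I: "(corr_weight d has_integral ?I) {t..1}"
    by (intro integrable_integral integrable_continuous_interval continuous_intros)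
  have "((\<lambda>r. corr_weight d (- r)) has_integral ?I) {- 1.. - t}"
    using I by (subst has_integral_reflect_real) simp_all
  then have I': "(corr_weight d has_integral ?I) {-1.. -t}"
    by (simp add: corr_weight_minus)
  have m: "measure (corr_law d) {a..b} = J / (2 * corr_mass d)"
    if "(corr_weight d has_integral J) {a..b}" "-1 \<le> a" "b \<le> 1" for a b J
  proof -
    have "has_bochner_integral (corr_law d) (\<lambda>r. indicator {a..b} r * 1) (J / (2 * corr_mass d))"
      using that by (intro has_bochner_integral_corr_law) auto
    then show ?thesis
      by (simp add: has_bochner_integral_iff)
  qed
  have "corr_tail d t = measure (corr_law d) ({-1.. -t} \<union> {t..1})"
    unfolding corr_tail_def
    by (rule corr_law.finite_measure_eq_AE) (use AE_corr_law_bounded[of d] t in \<open>auto elim!: eventually_mono\<close>)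
  also have "\<dots> = measure (corr_law d) {-1.. -t} + measure (corr_law d) {t..1}"
    using t by (intro corr_law.finite_measure_Union) auto
  also have "\<dots> = ?I / corr_mass d"
    using t by (simp add: m[OF I] m[OF I'] field_simps)
  finally show ?thesis .
qed

section \<open>Asymptotics of the tail\<close>

text \<open>
  Integrate the derivative of \<open>r (1 - r\<^sup>2)\<^bsup>(d + 2) / 2\<^esup>\<close>.
\<close>

lemma corr_mass_recurrence: "(real d + 3) * corr_mass (d + 2) = (real d + 2) * corr_mass d"
proof -
  have I: "(corr_weight e has_integral corr_mass e) {0..1}" for e
    unfolding corr_mass_def
    by (intro integrable_integral integrable_continuous_interval continuous_intros)
  have "((\<lambda>r. (real d + 3) * corr_weight (d + 2) r - (real d + 2) * corr_weight d r)
      has_integral (1 * corr_weight (d + 2) 1 - 0 * corr_weight (d + 2) 0)) {0..1}"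
  proof (rule has_integral_by_interior_derivative)
    fix r :: real assume "0 < r" "r < 1"
    then have r: "\<bar>r\<bar> < 1" by simp
    have "((\<lambda>r. r * corr_weight (d + 2) r) has_real_derivative
        1 * corr_weight (d + 2) r + (- real (d + 2) * r * corr_weight d r) * r) (at r)"
      by (rule DERIV_mult[OF DERIV_ident corr_weight_derivative[OF r]])
    moreover have "1 * corr_weight (d + 2) r + (- real (d + 2) * r * corr_weight d r) * r =
        (real d + 3) * corr_weight (d + 2) r - (real d + 2) * corr_weight d r"
      using r by (subst (1 2) corr_weight_add_2) (simp_all add: algebra_simps power2_eq_square)
    ultimately show "((\<lambda>r. r * corr_weight (d + 2) r) has_real_derivative
        (real d + 3) * corr_weight (d + 2) r - (real d + 2) * corr_weight d r) (at r)"
      by (simp only:)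
  qed (auto intro!: continuous_intros)
  then have *: "((\<lambda>r. (real d + 3) * corr_weight (d + 2) r - (real d + 2) * corr_weight d r) has_integral 0) {0..1}"
    by (simp add: corr_weight_def)
  have "(real d + 3) * corr_mass (d + 2) - (real d + 2) * corr_mass d = 0"
    by (rule has_integral_unique[OF _ *]) (intro has_integral_diff has_integral_mult_right I)
  then show ?thesis by simp
qed

lemma corr_mass_0: "corr_mass 0 = 1"
  by (simp add: corr_mass_def corr_weight_def[abs_def])

lemma corr_mass_1: "corr_mass 1 = pi / 4"
proof -
  have "(corr_weight 1 has_integral
      ((1 * sqrt (1 - 1\<^sup>2) + arcsin 1) / 2 - (0 * sqrt (1 - 0\<^sup>2) + arcsin 0) / 2)) {0..1}"
  proof (rule has_integral_by_interior_derivative)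
    fix r :: real assume "0 < r" "r < 1"
    then have pos: "1 - r\<^sup>2 > 0"
      by (intro one_minus_square_pos) simp
    have D: "((\<lambda>r. 1 - r\<^sup>2) has_real_derivative - 2 * r) (at r)"
      by (auto intro!: derivative_eq_intros)
    have "((\<lambda>r. (r * sqrt (1 - r\<^sup>2) + arcsin r) / 2) has_real_derivative
        (1 * sqrt (1 - r\<^sup>2) + (inverse (sqrt (1 - r\<^sup>2)) / 2 * (- 2 * r)) * r + inverse (sqrt (1 - r\<^sup>2))) / 2) (at r)"
      using \<open>0 < r\<close> \<open>r < 1\<close>
      by (intro DERIV_cdivide DERIV_add DERIV_mult DERIV_ident DERIV_chain2[OF DERIV_real_sqrt D] DERIV_arcsin pos) auto
    moreover have "(1 * sqrt (1 - r\<^sup>2) + (inverse (sqrt (1 - r\<^sup>2)) / 2 * (- 2 * r)) * r + inverse (sqrt (1 - r\<^sup>2))) / 2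
        = corr_weight 1 r"
      using pos by (simp add: corr_weight_def field_simps power2_eq_square)
    ultimately show "((\<lambda>r. (r * sqrt (1 - r\<^sup>2) + arcsin r) / 2) has_real_derivative corr_weight 1 r) (at r)"
      by (simp only:)
  qed (auto intro!: continuous_intros)
  then have "(corr_weight 1 has_integral pi / 4) {0..1}"
    by simp
  then show ?thesis
    by (simp add: corr_mass_def integral_unique)
qed

text \<open>
  Wallis' product in telescoped form. Monotonicity in \<open>d\<close> then encloses the square of a single mass
  between two such products.
\<close>

lemma corr_mass_wallis: "corr_mass d * corr_mass (d + 1) = pi / (2 * (real d + 2))"
proof (induction d)
  case 0
  show ?case using corr_mass_1 by (simp add: corr_mass_0)
next
  case (Suc d)
  have "(real d + 3) * (corr_mass (d + 1) * corr_mass (d + 2)) = (real d + 2) * (corr_mass d * corr_mass (d + 1))"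
    using corr_mass_recurrence[of d] by (simp add: algebra_simps)
  also have "\<dots> = pi / 2"
    unfolding Suc by (simp add: field_simps)
  finally show ?case
    by (simp add: field_simps One_nat_def)
qed

lemma corr_mass_antimono: "corr_mass (d + 1) \<le> corr_mass d"
  unfolding corr_mass_def
proof (rule integral_le)
  fix r :: real assume "r \<in> {0..1}"
  then have "sqrt (1 - r\<^sup>2) \<le> 1" "sqrt (1 - r\<^sup>2) \<ge> 0"
    by (auto simp: abs_square_le_1)
  then show "corr_weight (d + 1) r \<le> corr_weight d r"
    unfolding corr_weight_def by (intro power_decreasing) auto
qed (auto intro!: integrable_continuous_interval continuous_intros)

lemma corr_mass_square_lower: "(corr_mass d)\<^sup>2 \<ge> pi / (2 * (real d + 2))"
  unfolding corr_mass_wallis[symmetric] power2_eq_square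
  using corr_mass_antimono[of d] corr_mass_pos[of d] by (intro mult_left_mono) auto

lemma corr_mass_square_upper: "(corr_mass (d + 1))\<^sup>2 \<le> pi / (2 * (real d + 2))"
  unfolding corr_mass_wallis[symmetric] power2_eq_square
  using corr_mass_antimono[of d] corr_mass_pos[of "d + 1"] by (intro mult_right_mono) auto

lemma corr_mass_asymptotic: "(\<lambda>n. (real n - 2) * corr_mass (n - 4) / sqrt (real n)) \<longlonglongrightarrow> sqrt (pi / 2)"
proof -
  let ?f = "\<lambda>n. (real n - 2)\<^sup>2 * (corr_mass (n - 4))\<^sup>2 / real n"
  have "?f \<longlonglongrightarrow> pi / 2"
  proof (rule tendsto_sandwich)
    show "\<forall>\<^sub>F n in sequentially. (real n - 2)\<^sup>2 * (pi / (2 * (real n - 2))) / real n \<le> ?f n"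
      using eventually_ge_at_top[of 5]
    proof eventually_elim
      case (elim n)
      then have "(corr_mass (n - 4))\<^sup>2 \<ge> pi / (2 * (real n - 2))"
        using corr_mass_square_lower[of "n - 4"] by (simp add: of_nat_diff)
      then show ?case
        by (intro divide_right_mono mult_left_mono) auto
    qed
    show "\<forall>\<^sub>F n in sequentially. ?f n \<le> (real n - 2)\<^sup>2 * (pi / (2 * (real n - 3))) / real n"
      using eventually_ge_at_top[of 5]
    proof eventually_elim
      case (elim n)
      then have "n - 4 = (n - 5) + 1" by simp
      then have "(corr_mass (n - 4))\<^sup>2 \<le> pi / (2 * (real n - 3))"
        using corr_mass_square_upper[of "n - 5"] elim by (simp add: of_nat_diff)
      then show ?case
        by (intro divide_right_mono mult_left_mono) auto
    qed
    show "(\<lambda>n. (real n - 2)\<^sup>2 * (pi / (2 * (real n - 2))) / real n) \<longlonglongrightarrow> pi / 2"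
      by real_asymp
    show "(\<lambda>n. (real n - 2)\<^sup>2 * (pi / (2 * (real n - 3))) / real n) \<longlonglongrightarrow> pi / 2"
      by real_asymp
  qed
  then have "(\<lambda>n. sqrt (?f n)) \<longlonglongrightarrow> sqrt (pi / 2)"
    by (rule tendsto_real_sqrt)
  moreover have "\<forall>\<^sub>F n in sequentially. sqrt (?f n) = (real n - 2) * corr_mass (n - 4) / sqrt (real n)"
    using eventually_ge_at_top[of 2]
  proof eventually_elim
    case (elim n)
    then show ?case
      using corr_mass_pos[of "n - 4"] by (simp add: real_sqrt_mult real_sqrt_divide)
  qed
  ultimately show ?thesis
    by (rule Lim_transform_eventually)
qed

text \<open>
  The analogue of Mills' ratio. The function \<open>- corr_weight (d + 2) r / ((d + 2) r)\<close> has derivative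
  \<open>corr_weight d r\<close> plus a nonnegative term, and for \<open>r \<ge> t\<close> that term is at most
  \<open>1 / ((d + 2) t\<^sup>2)\<close> times \<open>corr_weight d r\<close>.
\<close>

lemma corr_tail_bounds:
  fixes d :: nat and t :: real
  assumes t: "0 < t" "t \<le> 1"
  defines "R \<equiv> corr_weight (d + 2) t / ((real d + 2) * t * corr_mass d)"
  shows "corr_tail d t \<le> R" "R \<le> corr_tail d t * (1 + 1 / ((real d + 2) * t\<^sup>2))"
proof -
  let ?k = "real d + 2"
  let ?I = "integral {t..1} (corr_weight d)"
  let ?h = "\<lambda>r. corr_weight d r + corr_weight (d + 2) r / (?k * r\<^sup>2)"
  have I: "(corr_weight d has_integral ?I) {t..1}"
    by (intro integrable_integral integrable_continuous_interval continuous_intros)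
  have "(?h has_integral (- corr_weight (d + 2) 1 / (?k * 1) - - corr_weight (d + 2) t / (?k * t))) {t..1}"
  proof (rule has_integral_by_interior_derivative)
    fix r assume r: "t < r" "r < 1"
    then have r': "\<bar>r\<bar> < 1" "r \<noteq> 0"
      using t by auto
    have "((\<lambda>r. - corr_weight (d + 2) r / (?k * r)) has_real_derivative
        ((- (- real (d + 2) * r * corr_weight d r)) * (?k * r) - (- corr_weight (d + 2) r) * (?k * 1)) / ((?k * r) * (?k * r))) (at r)"
      using r' by (intro DERIV_divide DERIV_minus corr_weight_derivative DERIV_cmult DERIV_ident) auto
    moreover have "((- (- real (d + 2) * r * corr_weight d r)) * (?k * r) - (- corr_weight (d + 2) r) * (?k * 1)) / ((?k * r) * (?k * r)) = ?h r"
      using r' by (simp add: divide_simps) (simp add: algebra_simps power2_eq_square)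
    ultimately show "((\<lambda>r. - corr_weight (d + 2) r / (?k * r)) has_real_derivative ?h r) (at r)"
      by (simp only:)
  qed (use t in \<open>auto intro!: continuous_intros\<close>)
  then have h: "(?h has_integral corr_weight (d + 2) t / (?k * t)) {t..1}"
    by (simp add: corr_weight_def)
  have le: "0 \<le> corr_weight (d + 2) r / (?k * r\<^sup>2)"
      "corr_weight (d + 2) r / (?k * r\<^sup>2) \<le> corr_weight d r * (1 / (?k * t\<^sup>2))" if "r \<in> {t..1}" for r
  proof -
    have r: "\<bar>r\<bar> \<le> 1" "t\<^sup>2 \<le> r\<^sup>2" "r\<^sup>2 > 0" "t\<^sup>2 > 0"
      using that t by (auto intro: power_mono)
    show "0 \<le> corr_weight (d + 2) r / (?k * r\<^sup>2)"
      using r by (intro divide_nonneg_nonneg corr_weight_nonneg) auto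
    have "corr_weight (d + 2) r \<le> corr_weight d r"
      unfolding corr_weight_add_2[OF r(1)] using corr_weight_nonneg[OF r(1), of d] r
      by (intro mult_right_le_one_le) (auto simp: abs_square_le_1)
    then have "corr_weight (d + 2) r / (?k * r\<^sup>2) \<le> corr_weight d r / (?k * t\<^sup>2)"
      using r corr_weight_nonneg[OF r(1), of d] by (intro frac_le mult_left_mono mult_pos_pos) auto
    then show "corr_weight (d + 2) r / (?k * r\<^sup>2) \<le> corr_weight d r * (1 / (?k * t\<^sup>2))"
      by simp
  qed
  have tail: "corr_tail d t = ?I / corr_mass d"
    by (rule corr_tail_eq[OF t])
  have R: "R = (corr_weight (d + 2) t / (?k * t)) / corr_mass d"
    by (simp add: R_def)
  have "?I \<le> corr_weight (d + 2) t / (?k * t)"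
    by (rule has_integral_le[OF I h]) (use le in auto)
  then show "corr_tail d t \<le> R"
    unfolding tail R using corr_mass_pos[of d] by (intro divide_right_mono) auto
  have "corr_weight (d + 2) t / (?k * t) \<le> ?I * (1 + 1 / (?k * t\<^sup>2))"
    by (rule has_integral_le[OF h has_integral_mult_left[OF I]])
       (use le in \<open>auto simp: algebra_simps\<close>)
  then have "R \<le> ?I * (1 + 1 / (?k * t\<^sup>2)) / corr_mass d"
    unfolding R using corr_mass_pos[of d] by (intro divide_right_mono) auto
  then show "R \<le> corr_tail d t * (1 + 1 / (?k * t\<^sup>2))"
    unfolding tail by simp
qed

lemma corr_tail_1: "corr_tail d 1 = 0"
  by (subst corr_tail_eq) auto

lemma corr_tail_le_power:
  assumes t: "0 < t" "t \<le> 1"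
  shows "corr_tail d t \<le> sqrt (1 - t\<^sup>2) ^ (d + 2) / t"
proof -
  have "sqrt 1 \<le> sqrt ((real d + 2) * (corr_mass d)\<^sup>2)"
    using corr_mass_square_lower[of d] pi_gt3 by (intro real_sqrt_le_mono) (simp add: field_simps)
  also have "\<dots> \<le> sqrt ((real d + 2)\<^sup>2 * (corr_mass d)\<^sup>2)"
    by (intro real_sqrt_le_mono mult_right_mono) (auto simp: power2_eq_square intro: mult_left_mono)
  also have "\<dots> = (real d + 2) * corr_mass d"
    using corr_mass_pos[of d] by (simp add: real_sqrt_mult)
  finally have "t * 1 \<le> t * ((real d + 2) * corr_mass d)"
    using t by (intro mult_left_mono) auto
  then have "corr_weight (d + 2) t / ((real d + 2) * t * corr_mass d) \<le> corr_weight (d + 2) t / t"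
    using t by (intro divide_left_mono corr_weight_nonneg mult_pos_pos corr_mass_pos) (auto simp: mult_ac)
  then show ?thesis
    using corr_tail_bounds(1)[OF t, of d] by (simp add: corr_weight_def)
qed

text \<open>
  The tail is at most \<open>c\<^bsup>n - 2\<^esup> / t\<close> with \<open>c = sqrt (1 - t\<^sup>2) < 1\<close>, while \<open>p\<^sup>2 = exp (2 ln p)\<close> grows more
  slowly than any exponential in \<open>n\<close>.
\<close>

lemma square_times_corr_tail_fixed:
  fixes p :: "nat \<Rightarrow> nat"
  assumes p: "eventually (\<lambda>n. p n \<ge> 1) sequentially"
    and lim: "(\<lambda>n. ln (real (p n)) / real n) \<longlonglongrightarrow> 0" and t: "0 < t" "t < 1"
  shows "(\<lambda>n. (real (p n))\<^sup>2 * corr_tail (n - 4) t) \<longlonglongrightarrow> 0"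
proof -
  define c where "c = sqrt (1 - t\<^sup>2)"
  have c: "0 < c" "c < 1"
    using t by (auto simp: c_def abs_square_less_1)
  then have "ln c < 0" by simp
  let ?e = "\<lambda>n. real n * (2 * (ln (real (p n)) / real n) + ln c - 2 * ln c / real n)"
  have "(\<lambda>n. 2 * (ln (real (p n)) / real n) + ln c - 2 * ln c / real n) \<longlonglongrightarrow> 2 * 0 + ln c - 0"
    by (intro tendsto_intros lim lim_const_over_n)
  then have "filterlim ?e at_bot sequentially"
    using \<open>ln c < 0\<close> filterlim_real_sequentially
    by (subst mult.commute, intro filterlim_tendsto_neg_mult_at_bot[where c = "ln c"]) auto
  then have "(\<lambda>n. exp (?e n)) \<longlonglongrightarrow> 0"
    by (rule filterlim_compose[OF exp_at_bot])
  then have "(\<lambda>n. exp (?e n) / t) \<longlonglongrightarrow> 0 / t"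
    by (rule tendsto_divide) (use t in auto)
  then have lim0: "(\<lambda>n. exp (?e n) / t) \<longlonglongrightarrow> 0" by simp
  show ?thesis
  proof (rule tendsto_sandwich[OF _ _ tendsto_const lim0])
    show "\<forall>\<^sub>F n in sequentially. (real (p n))\<^sup>2 * corr_tail (n - 4) t \<le> exp (?e n) / t"
      using p eventually_ge_at_top[of 5]
    proof eventually_elim
      case (elim n)
      have "?e n = 2 * ln (real (p n)) + real (n - 2) * ln c"
        using elim by (simp add: field_simps of_nat_diff)
      then have "exp (?e n) = exp (ln (real (p n))) ^ 2 * exp (ln c) ^ (n - 2)"
        by (simp only: exp_add exp_double exp_of_nat_mult)
      moreover have "n - 2 = n - 4 + 2"
        using elim by simp
      ultimately have "exp (?e n) = (real (p n))\<^sup>2 * c ^ (n - 4 + 2)"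
        using elim c by simp
      then show ?case
        using mult_left_mono[OF corr_tail_le_power[of t "n - 4"], of "(real (p n))\<^sup>2"] t
        by (simp add: c_def)
    qed
  qed (simp add: corr_tail_def)
qed

text \<open>
  Here \<open>s\<close> is the value of \<open>T\<close> for which \<open>n T + 4 ln p - ln ln p = y\<close>, and \<open>t = sqrt (1 - exp s)\<close> is the
  corresponding value of \<open>L\<close>. Since \<open>1 - t\<^sup>2 = exp s\<close>, the numerator of the bounds in
  \<open>corr_tail_bounds\<close> equals \<open>exp ((n - 2) s / 2) = exp (y / 2) p\<^sup>-\<^sup>2 sqrt (ln p) exp (- s)\<close>. From \<open>s \<rightarrow> 0\<close> and
  \<open>n t\<^sup>2 \<sim> - n s \<sim> 4 ln p\<close> the quotient \<open>sqrt (ln p) / t\<close> is asymptotic to \<open>sqrt n / 2\<close>, and the normalising mass is asymptotic to \<open>sqrt (pi / (2 n))\<close>. So \<open>p\<^sup>2 q\<close> tends to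
  \<open>exp (y / 2) / sqrt (2 pi)\<close>; passing from \<open>p\<^sup>2\<close> to the number of pairs halves the limit. Divergence of
  \<open>n t\<^sup>2\<close> makes the two bounds on the tail asymptotically equal.
\<close>

lemma pairs_times_corr_tail_critical:
  fixes p :: "nat \<Rightarrow> nat" and y :: real
  defines "s \<equiv> \<lambda>n. (y - 4 * ln (real (p n)) + ln (ln (real (p n)))) / real n"
  assumes p: "filterlim p at_top sequentially"
    and lim: "(\<lambda>n. ln (real (p n)) / real n) \<longlonglongrightarrow> 0"
  shows "\<forall>\<^sub>F n in sequentially. s n < 0"
    and "(\<lambda>n. real (p n) * (real (p n) - 1) / 2 * corr_tail (n - 4) (sqrt (1 - exp (s n))))
      \<longlonglongrightarrow> exp (y / 2) / sqrt (8 * pi)"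
    and "(\<lambda>n. 4 * real (p n) ^ 3 * (corr_tail (n - 4) (sqrt (1 - exp (s n))))\<^sup>2) \<longlonglongrightarrow> 0"
proof -
  define l where "l = (\<lambda>n. ln (real (p n)))"
  define t where "t = (\<lambda>n. sqrt (1 - exp (s n)))"
  define q where "q = (\<lambda>n. corr_tail (n - 4) (t n))"
  have p_real: "filterlim (\<lambda>n. real (p n)) at_top sequentially"
    by (rule filterlim_compose[OF filterlim_real_sequentially p])
  have l: "filterlim l at_top sequentially"
    unfolding l_def by (rule filterlim_compose[OF ln_at_top p_real])
  have l_pos: "\<forall>\<^sub>F n in sequentially. l n > 0"
    using l by (simp add: filterlim_at_top_dense)
  have l_n: "(\<lambda>n. l n / real n) \<longlonglongrightarrow> 0"
    using lim by (simp add: l_def)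
  have "((\<lambda>x::real. (4 * x - ln x - y) / (4 * x)) \<longlongrightarrow> 1) at_top"
    by real_asymp
  from filterlim_compose[OF this l]
  have ratio: "(\<lambda>n. (4 * l n - ln (l n) - y) / (4 * l n)) \<longlonglongrightarrow> 1" .
  have s_eq: "s n = - ((4 * l n - ln (l n) - y) / (4 * l n)) * (4 * (l n / real n))" if "l n > 0" for n
    using that by (simp add: s_def l_def divide_simps)
  have s0: "s \<longlonglongrightarrow> 0"
  proof (rule Lim_transform_eventually)
    show "(\<lambda>n. - ((4 * l n - ln (l n) - y) / (4 * l n)) * (4 * (l n / real n))) \<longlonglongrightarrow> 0"
      by (rule tendsto_eq_intros ratio l_n refl)+ simp
    show "\<forall>\<^sub>F n in sequentially. - ((4 * l n - ln (l n) - y) / (4 * l n)) * (4 * (l n / real n)) = s n"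
      using l_pos by eventually_elim (simp add: s_eq)
  qed
  show s_neg: "\<forall>\<^sub>F n in sequentially. s n < 0"
    using l_pos order_tendstoD(1)[OF ratio zero_less_one] eventually_gt_at_top[of 0]
  proof eventually_elim
    case (elim n)
    then have "4 * l n - ln (l n) - y > 0"
      by (simp add: zero_less_divide_iff)
    with elim show ?case
      by (simp add: s_def l_def divide_neg_pos)
  qed
  have t_pos: "\<forall>\<^sub>F n in sequentially. 0 < t n \<and> t n \<le> 1"
    using s_neg by eventually_elim (auto simp: t_def)

  \<comment> \<open>\<open>t\<^sup>2\<close> is asymptotic to \<open>- s\<close>, hence \<open>n t\<^sup>2\<close> to \<open>4 ln p\<close>\<close>
  have "((\<lambda>x::real. (1 - exp x) / (- x)) \<longlongrightarrow> 1) (at_left 0)"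
    by real_asymp
  moreover have "filterlim s (at_left 0) sequentially"
    using s0 s_neg by (auto simp: filterlim_at elim: eventually_mono)
  ultimately have ts: "(\<lambda>n. (1 - exp (s n)) / (- s n)) \<longlonglongrightarrow> 1"
    by (rule filterlim_compose)
  have t2: "(\<lambda>n. real n * (t n)\<^sup>2 / (4 * l n)) \<longlonglongrightarrow> 1"
  proof (rule Lim_transform_eventually)
    show "(\<lambda>n. (1 - exp (s n)) / (- s n) * ((4 * l n - ln (l n) - y) / (4 * l n))) \<longlonglongrightarrow> 1"
      using tendsto_mult[OF ts ratio] by simp
    show "\<forall>\<^sub>F n in sequentially. (1 - exp (s n)) / (- s n) * ((4 * l n - ln (l n) - y) / (4 * l n)) =
        real n * (t n)\<^sup>2 / (4 * l n)"
      using l_pos s_neg eventually_gt_at_top[of 0]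
    proof eventually_elim
      case (elim n)
      have t2: "(t n)\<^sup>2 = 1 - exp (s n)"
        using elim by (simp add: t_def)
      have num: "4 * l n - ln (l n) - y = - s n * real n"
        using elim by (simp add: s_def l_def)
      then show ?case
        unfolding t2 num using elim by (simp add: field_simps)
    qed
  qed
  have n_t2: "filterlim (\<lambda>n. real n * (t n)\<^sup>2) at_top sequentially"
  proof (rule filterlim_cong[THEN iffD1, OF refl refl])
    show "filterlim (\<lambda>n. real n * (t n)\<^sup>2 / (4 * l n) * (4 * l n)) at_top sequentially"
      by (rule filterlim_tendsto_pos_mult_at_top[OF t2 _ filterlim_tendsto_pos_mult_at_top[OF tendsto_const _ l]]) auto
    show "\<forall>\<^sub>F n in sequentially. real n * (t n)\<^sup>2 / (4 * l n) * (4 * l n) = real n * (t n)\<^sup>2"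
      using l_pos by eventually_elim simp
  qed

  define R where "R = (\<lambda>n. corr_weight (n - 4 + 2) (t n) / ((real (n - 4) + 2) * t n * corr_mass (n - 4)))"
  have R_lim: "(\<lambda>n. (real (p n))\<^sup>2 * R n) \<longlonglongrightarrow> exp (y / 2) / sqrt (2 * pi)"
  proof (rule Lim_transform_eventually)
    have "(\<lambda>n. exp (y / 2) * exp (- s n) * ((1 / 2) / sqrt (real n * (t n)\<^sup>2 / (4 * l n))) /
        ((real n - 2) * corr_mass (n - 4) / sqrt (real n)))
        \<longlonglongrightarrow> exp (y / 2) * exp (- 0) * ((1 / 2) / sqrt 1) / sqrt (pi / 2)"
      by (intro tendsto_intros s0 t2 corr_mass_asymptotic) auto
    also have "exp (y / 2) * exp (- 0) * ((1 / 2) / sqrt 1) / sqrt (pi / 2) = exp (y / 2) / sqrt (2 * pi)"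
      by (simp add: real_sqrt_divide real_sqrt_mult field_simps)
    finally show "(\<lambda>n. exp (y / 2) * exp (- s n) * ((1 / 2) / sqrt (real n * (t n)\<^sup>2 / (4 * l n))) /
        ((real n - 2) * corr_mass (n - 4) / sqrt (real n))) \<longlonglongrightarrow> exp (y / 2) / sqrt (2 * pi)" .
    show "\<forall>\<^sub>F n in sequentially. exp (y / 2) * exp (- s n) * ((1 / 2) / sqrt (real n * (t n)\<^sup>2 / (4 * l n))) /
        ((real n - 2) * corr_mass (n - 4) / sqrt (real n)) = (real (p n))\<^sup>2 * R n"
      using l_pos s_neg t_pos eventually_ge_at_top[of 5]
    proof eventually_elim
      case (elim n)
      have p_pos: "real (p n) > 0"
        using elim by (cases "p n = 0") (auto simp: l_def)
      have "n - 4 + 2 = n - 2"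
        using elim by simp
      then have "corr_weight (n - 4 + 2) (t n) = sqrt (exp (s n)) ^ (n - 2)"
        using elim by (simp only: corr_weight_def) (simp add: t_def)
      also have "sqrt (exp (s n)) = exp (s n / 2)"
        by (rule real_sqrt_unique) (simp_all add: exp_of_nat_mult[symmetric])
      also have "exp (s n / 2) ^ (n - 2) = exp (real (n - 2) * (s n / 2))"
        by (rule exp_of_nat_mult[symmetric])
      also have "real (n - 2) * (s n / 2) = real n * s n / 2 - s n"
        using elim by (simp add: of_nat_diff field_simps)
      also have "real n * s n / 2 = y / 2 - 2 * l n + ln (l n) / 2"
        using elim by (simp add: s_def l_def)
      also have "exp (y / 2 - 2 * l n + ln (l n) / 2 - s n) = exp (y / 2) * (exp (ln (l n) / 2) / (exp (l n) ^ 2)) * exp (- s n)"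
        by (simp only: exp_add exp_diff exp_minus exp_double) (simp add: divide_simps)
      also have "exp (ln (l n) / 2) = sqrt (l n)"
        using elim by (simp add: powr_half_sqrt[symmetric] powr_def)
      also have "exp (l n) = real (p n)"
        using p_pos by (simp add: l_def)
      finally have w: "(real (p n))\<^sup>2 * corr_weight (n - 4 + 2) (t n) = exp (y / 2) * exp (- s n) * sqrt (l n)"
        using p_pos by simp
      have sq: "sqrt (real n * (t n)\<^sup>2 / (4 * l n)) = sqrt (real n) * t n / (2 * sqrt (l n))"
        using elim by (simp add: real_sqrt_divide real_sqrt_mult)
      have "(real (p n))\<^sup>2 * R n = exp (y / 2) * exp (- s n) * sqrt (l n) / ((real n - 2) * t n * corr_mass (n - 4))"
        unfolding R_def times_divide_eq_right w using elim by (simp add: of_nat_diff)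
      also have "\<dots> = exp (y / 2) * exp (- s n) * ((1 / 2) / (sqrt (real n) * t n / (2 * sqrt (l n)))) /
          ((real n - 2) * corr_mass (n - 4) / sqrt (real n))"
        using elim by (simp add: divide_simps)
      finally show ?case
        unfolding sq ..
    qed
  qed
  have pq: "(\<lambda>n. (real (p n))\<^sup>2 * q n) \<longlonglongrightarrow> exp (y / 2) / sqrt (2 * pi)"
  proof (rule tendsto_sandwich[OF _ _ _ R_lim])
    show "\<forall>\<^sub>F n in sequentially. (real (p n))\<^sup>2 * q n \<le> (real (p n))\<^sup>2 * R n"
      using t_pos unfolding q_def R_def
      by eventually_elim (intro mult_left_mono corr_tail_bounds; simp)
    have "filterlim (\<lambda>n. (1 / 2) * (real n * (t n)\<^sup>2)) at_top sequentially"
      by (rule filterlim_tendsto_pos_mult_at_top[OF tendsto_const _ n_t2]) simp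
    then have "(\<lambda>n. 1 / ((1 / 2) * (real n * (t n)\<^sup>2))) \<longlonglongrightarrow> 0"
      by (rule tendsto_divide_0[OF tendsto_const filterlim_at_top_imp_at_infinity])
    then have "(\<lambda>n. (real (p n))\<^sup>2 * R n / (1 + 1 / ((1 / 2) * (real n * (t n)\<^sup>2)))) \<longlonglongrightarrow>
        exp (y / 2) / sqrt (2 * pi) / (1 + 0)"
      by (intro tendsto_intros R_lim) auto
    then show "(\<lambda>n. (real (p n))\<^sup>2 * R n / (1 + 1 / ((1 / 2) * (real n * (t n)\<^sup>2)))) \<longlonglongrightarrow>
        exp (y / 2) / sqrt (2 * pi)"
      by simp
    show "\<forall>\<^sub>F n in sequentially. (real (p n))\<^sup>2 * R n / (1 + 1 / ((1 / 2) * (real n * (t n)\<^sup>2))) \<le> (real (p n))\<^sup>2 * q n"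
      using t_pos eventually_ge_at_top[of 5]
    proof eventually_elim
      case (elim n)
      let ?a = "1 / ((1 / 2) * (real n * (t n)\<^sup>2))"
      have t2: "(t n)\<^sup>2 > 0"
        using elim by simp
      have "R n \<le> q n * (1 + 1 / ((real (n - 4) + 2) * (t n)\<^sup>2))"
        unfolding R_def q_def using elim by (intro corr_tail_bounds) auto
      also have "\<dots> \<le> q n * (1 + ?a)"
      proof (intro mult_left_mono add_left_mono divide_left_mono)
        have "(1 / 2 * real n) * (t n)\<^sup>2 \<le> (real (n - 4) + 2) * (t n)\<^sup>2"
          using elim by (intro mult_right_mono) (auto simp: of_nat_diff)
        then show "1 / 2 * (real n * (t n)\<^sup>2) \<le> (real (n - 4) + 2) * (t n)\<^sup>2"
          by simp
      qed (use elim t2 in \<open>auto simp: q_def corr_tail_def intro!: mult_pos_pos\<close>)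
      finally have "R n / (1 + ?a) \<le> q n"
        using elim t2 by (subst pos_divide_le_eq) (auto intro!: add_pos_nonneg)
      then have "(real (p n))\<^sup>2 * (R n / (1 + ?a)) \<le> (real (p n))\<^sup>2 * q n"
        by (rule mult_left_mono) simp
      then show ?case
        by simp
    qed
  qed
  have inv_p: "(\<lambda>n. 1 / real (p n)) \<longlonglongrightarrow> 0"
    by (rule tendsto_divide_0[OF tendsto_const filterlim_at_top_imp_at_infinity[OF p_real]])
  have p_pos: "\<forall>\<^sub>F n in sequentially. real (p n) > 0"
    using p_real unfolding filterlim_at_top_dense by blast
  show "(\<lambda>n. real (p n) * (real (p n) - 1) / 2 * corr_tail (n - 4) (sqrt (1 - exp (s n))))
      \<longlonglongrightarrow> exp (y / 2) / sqrt (8 * pi)"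
  proof (rule Lim_transform_eventually)
    have "(\<lambda>n. (1 - 1 / real (p n)) / 2 * ((real (p n))\<^sup>2 * q n)) \<longlonglongrightarrow> (1 - 0) / 2 * (exp (y / 2) / sqrt (2 * pi))"
      by (intro tendsto_intros inv_p pq) auto
    also have "sqrt (8 * pi) = 2 * sqrt (2 * pi)"
      using real_sqrt_mult[of 4 "2 * pi"] by simp
    then have "(1 - 0) / 2 * (exp (y / 2) / sqrt (2 * pi)) = exp (y / 2) / sqrt (8 * pi)"
      by simp
    finally show "(\<lambda>n. (1 - 1 / real (p n)) / 2 * ((real (p n))\<^sup>2 * q n)) \<longlonglongrightarrow> exp (y / 2) / sqrt (8 * pi)" .
    show "\<forall>\<^sub>F n in sequentially. (1 - 1 / real (p n)) / 2 * ((real (p n))\<^sup>2 * q n) =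
        real (p n) * (real (p n) - 1) / 2 * corr_tail (n - 4) (sqrt (1 - exp (s n)))"
      using p_pos by eventually_elim (simp add: q_def t_def field_simps power2_eq_square)
  qed
  show "(\<lambda>n. 4 * real (p n) ^ 3 * (corr_tail (n - 4) (sqrt (1 - exp (s n))))\<^sup>2) \<longlonglongrightarrow> 0"
  proof (rule Lim_transform_eventually)
    have "(\<lambda>n. 4 * (1 / real (p n)) * ((real (p n))\<^sup>2 * q n)\<^sup>2) \<longlonglongrightarrow> 4 * 0 * (exp (y / 2) / sqrt (2 * pi))\<^sup>2"
      by (intro tendsto_intros inv_p pq)
    then show "(\<lambda>n. 4 * (1 / real (p n)) * ((real (p n))\<^sup>2 * q n)\<^sup>2) \<longlonglongrightarrow> 0"
      by simp
    show "\<forall>\<^sub>F n in sequentially. 4 * (1 / real (p n)) * ((real (p n))\<^sup>2 * q n)\<^sup>2 =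
        4 * real (p n) ^ 3 * (corr_tail (n - 4) (sqrt (1 - exp (s n))))\<^sup>2"
      using p_pos by eventually_elim
        (simp add: q_def t_def field_simps power2_eq_square power3_eq_cube)
  qed
qed

section \<open>Poisson approximation for locally dependent events\<close>

lemma abs_power_diff_le:
  fixes s :: real
  assumes "0 \<le> s" "s \<le> 1"
  shows "\<bar>s ^ (a + k) - s ^ a\<bar> \<le> real k"
proof (cases "k = 0")
  case False
  have "0 \<le> s ^ a * s ^ k" "s ^ a * s ^ k \<le> s ^ a" "s ^ a \<le> 1"
    using assms by (auto intro: mult_left_le power_le_one)
  then show ?thesis
    using False unfolding power_add by (auto simp: abs_if intro: order_trans[of _ 1])
qed simp

context prob_space
begin

lemma expectation_nat_eq_sum:
  fixes f :: "nat \<Rightarrow> real"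
  assumes W [measurable]: "W \<in> measurable M (count_space UNIV)" and bound: "\<And>\<omega>. W \<omega> \<le> n"
  shows "expectation (\<lambda>\<omega>. f (W \<omega>)) = (\<Sum>k\<le>n. prob {\<omega> \<in> space M. W \<omega> = k} * f k)"
proof -
  have "f (W \<omega>) = (\<Sum>k\<le>n. f k * indicator {\<omega> \<in> space M. W \<omega> = k} \<omega>)" if "\<omega> \<in> space M" for \<omega>
  proof -
    have "(\<Sum>k\<le>n. f k * indicator {\<omega> \<in> space M. W \<omega> = k} \<omega>) = (\<Sum>k\<in>{W \<omega>}. f k * indicator {\<omega> \<in> space M. W \<omega> = k} \<omega>)"
      using bound[of \<omega>] by (intro sum.mono_neutral_right) auto
    then show ?thesis using that by simp
  qed
  then have "expectation (\<lambda>\<omega>. f (W \<omega>)) =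
      expectation (\<lambda>\<omega>. \<Sum>k\<le>n. f k * indicator {\<omega> \<in> space M. W \<omega> = k} \<omega>)"
    by (rule Bochner_Integration.integral_cong[OF refl])
  also have "\<dots> = (\<Sum>k\<le>n. expectation (\<lambda>\<omega>. f k * indicator {\<omega> \<in> space M. W \<omega> = k} \<omega>))"
    by (rule Bochner_Integration.integral_sum)
      (auto intro!: integrable_mult_right integrable_real_indicator simp: emeasure_eq_measure)
  also have "\<dots> = (\<Sum>k\<le>n. prob {\<omega> \<in> space M. W \<omega> = k} * f k)"
    by (intro sum.cong refl) (simp add: mult.commute Int_absorb2)
  finally show ?thesis .
qed

text \<open>
  Let \<open>W\<close> count the events that occur and let \<open>\<phi> s = E s\<^sup>W\<close>, so that \<open>\<phi> 0\<close> is the probability that none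
  occurs. Then \<open>\<phi>' s\<close> is the sum over \<open>i\<close> of the expectations of \<open>s\<^bsup>W - 1\<^esup>\<close> on \<open>E i\<close>. Replacing \<open>W - 1\<close> by the
  number \<open>V i\<close> of events outside the neighbourhood \<open>B i\<close> costs at most the second sum in the bound; then
  \<open>E i\<close> splits off by independence, and replacing \<open>V i\<close> by \<open>W\<close> costs the first sum. Thus \<open>\<phi>' - \<Lambda> \<phi>\<close> is
  bounded by the claimed error on \<open>[0, 1]\<close>, and so is the derivative of \<open>\<phi> s exp (- \<Lambda> s)\<close>; this function
  takes the two values to be compared at 0 and 1.
\<close>

lemma void_probability_close_to_exp:
  fixes I :: "'i set" and E :: "'i \<Rightarrow> 'a set" and B :: "'i \<Rightarrow> 'i set"
  defines "V \<equiv> \<lambda>i \<omega>. card {j \<in> I - B i. \<omega> \<in> E j}"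
  assumes fin: "finite I"
    and E: "\<And>i. i \<in> I \<Longrightarrow> E i \<in> events"
    and B: "\<And>i. i \<in> I \<Longrightarrow> i \<in> B i" "\<And>i. i \<in> I \<Longrightarrow> B i \<subseteq> I"
    and indep: "\<And>i. i \<in> I \<Longrightarrow>
      indep_var borel (indicator (E i) :: _ \<Rightarrow> real) borel (\<lambda>\<omega>. real (V i \<omega>))"
  shows "\<bar>prob {\<omega> \<in> space M. \<forall>i\<in>I. \<omega> \<notin> E i} - exp (- (\<Sum>i\<in>I. prob (E i)))\<bar> \<le>
    (\<Sum>i\<in>I. (\<Sum>j\<in>B i. prob (E i) * prob (E j)) + (\<Sum>j\<in>B i - {i}. prob (E i \<inter> E j)))"
    (is "_ \<le> ?\<delta>")
proof -
  define W where "W = (\<lambda>\<omega>. card {i \<in> I. \<omega> \<in> E i})"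
  define \<phi> where "\<phi> = (\<lambda>s::real. expectation (\<lambda>\<omega>. s ^ W \<omega>))"
  define \<phi>' where "\<phi>' = (\<lambda>s::real. expectation (\<lambda>\<omega>. real (W \<omega>) * s ^ (W \<omega> - 1)))"
  define \<Lambda> where "\<Lambda> = (\<Sum>i\<in>I. prob (E i))"
  have finB: "finite (B i)" if "i \<in> I" for i
    using B(2)[OF that] fin by (rule finite_subset)
  have real_ind: "real (indicator A \<omega>) = indicator A \<omega>" for A :: "'a set" and \<omega>
    by (simp add: indicator_def)
  have card_eq: "card {j \<in> J. \<omega> \<in> E j} = (\<Sum>j\<in>J. indicator (E j) \<omega>)" if "finite J" for J \<omega>
    using that by (simp add: indicator_def sum.If_cases Int_def)
  have card_measurable: "(\<lambda>\<omega>. card {j \<in> J. \<omega> \<in> E j}) \<in> measurable M (count_space UNIV)" if "J \<subseteq> I" for J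
  proof -
    have "(\<lambda>\<omega>. indicator (E j) \<omega> :: nat) \<in> measurable M (count_space UNIV)" if "j \<in> J" for j
      using E[of j] \<open>J \<subseteq> I\<close> that
      unfolding indicator_def of_bool_def by (intro measurable_If_set) auto
    then show ?thesis
      by (simp add: card_eq finite_subset[OF \<open>J \<subseteq> I\<close> fin] measurable_sum_nat)
  qed
  have W_measurable [measurable]: "W \<in> measurable M (count_space UNIV)"
    unfolding W_def by (rule card_measurable) simp
  have V_measurable [measurable]: "V i \<in> measurable M (count_space UNIV)" for i
    unfolding V_def by (rule card_measurable) auto
  have W_le: "W \<omega> \<le> card I" for \<omega>
    unfolding W_def using fin by (intro card_mono) auto
  have int: "integrable M (\<lambda>\<omega>. f (W \<omega>) * s ^ g \<omega>)"
    if "0 \<le> s" "s \<le> 1" and [measurable]: "g \<in> measurable M (count_space UNIV)" for f and s :: real and g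
  proof (rule integrable_const_bound[of _ "\<Sum>k\<le>card I. \<bar>f k\<bar>"])
    have "\<bar>f (W \<omega>)\<bar> * \<bar>s ^ g \<omega>\<bar> \<le> (\<Sum>k\<le>card I. \<bar>f k\<bar>) * 1" for \<omega>
      using that W_le by (intro mult_mono member_le_sum) (auto simp: power_abs power_le_one sum_nonneg)
    then show "AE \<omega> in M. norm (f (W \<omega>) * s ^ g \<omega>) \<le> (\<Sum>k\<le>card I. \<bar>f k\<bar>)"
      by (simp add: abs_mult)
  qed measurable
  have int_pow: "integrable M (\<lambda>\<omega>. s ^ g \<omega>)"
    if "0 \<le> s" "s \<le> 1" "g \<in> measurable M (count_space UNIV)" for s :: real and g
    using int[OF that, of "\<lambda>_. 1"] by simp
  have int_ind_pow: "integrable M (\<lambda>\<omega>. indicator (E i) \<omega> * s ^ g \<omega>)"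
    if "i \<in> I" "0 \<le> s" "s \<le> 1" "g \<in> measurable M (count_space UNIV)" for s :: real and g i
    using integrable_real_mult_indicator[OF E[OF that(1)] int_pow[OF that(2-4)]] by (simp add: mult.commute)
  have int_ind: "integrable M (\<lambda>\<omega>. indicator A \<omega> :: real)" if "A \<in> events" for A
    using that by (simp add: emeasure_eq_measure)

  have deriv: "(\<phi> has_real_derivative \<phi>' s) (at s)" for s
  proof -
    have "\<phi> = (\<lambda>s. \<Sum>k\<le>card I. prob {\<omega> \<in> space M. W \<omega> = k} * s ^ k)"
      unfolding \<phi>_def by (rule ext, rule expectation_nat_eq_sum) (use W_le in auto)
    moreover have "\<phi>' s = (\<Sum>k\<le>card I. prob {\<omega> \<in> space M. W \<omega> = k} * (real k * s ^ (k - 1)))"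
      unfolding \<phi>'_def by (rule expectation_nat_eq_sum) (use W_le in auto)
    ultimately show ?thesis
      by (auto intro!: derivative_eq_intros sum.cong simp: One_nat_def)
  qed

  have bound: "\<bar>\<phi>' s - \<Lambda> * \<phi> s\<bar> \<le> ?\<delta>" if s: "0 \<le> s" "s \<le> 1" for s
  proof -
    have W_ind: "real (W \<omega>) = (\<Sum>i\<in>I. indicator (E i) \<omega>)" for \<omega>
      unfolding W_def card_eq[OF fin] by (simp add: real_ind)
    have "\<phi>' s = expectation (\<lambda>\<omega>. \<Sum>i\<in>I. indicator (E i) \<omega> * s ^ (W \<omega> - 1))"
      unfolding \<phi>'_def by (simp add: W_ind sum_distrib_right)
    also have "\<dots> = (\<Sum>i\<in>I. expectation (\<lambda>\<omega>. indicator (E i) \<omega> * s ^ (W \<omega> - 1)))"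
      by (rule Bochner_Integration.integral_sum) (rule int_ind_pow, use s in auto)
    finally have "\<phi>' s - \<Lambda> * \<phi> s =
        (\<Sum>i\<in>I. expectation (\<lambda>\<omega>. indicator (E i) \<omega> * s ^ (W \<omega> - 1)) - prob (E i) * \<phi> s)"
      by (simp add: \<Lambda>_def sum_subtractf sum_distrib_right)
    also have "\<bar>\<dots>\<bar> \<le> ?\<delta>"
    proof (rule order_trans[OF sum_abs], rule sum_mono)
      fix i assume i: "i \<in> I"
      let ?a = "expectation (\<lambda>\<omega>. indicator (E i) \<omega> * s ^ (W \<omega> - 1))"
      let ?b = "expectation (\<lambda>\<omega>. indicator (E i) \<omega> * s ^ V i \<omega>)"
      let ?c = "expectation (\<lambda>\<omega>. s ^ V i \<omega>)"
      have W_split: "W \<omega> = V i \<omega> + card {j \<in> B i. \<omega> \<in> E j}" for \<omega>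
      proof -
        have "{j \<in> I. \<omega> \<in> E j} = {j \<in> I - B i. \<omega> \<in> E j} \<union> {j \<in> B i. \<omega> \<in> E j}"
          using B(2)[OF i] by auto
        then show ?thesis
          unfolding W_def V_def using fin finB[OF i] by (simp add: card_Un_disjoint disjoint_iff)
      qed
      have b_eq: "?b = prob (E i) * ?c"
      proof -
        have "indep_var borel (id \<circ> indicator (E i)) borel ((\<lambda>x. s ^ nat \<lfloor>x\<rfloor>) \<circ> (\<lambda>\<omega>. real (V i \<omega>)))"
          by (rule indep_var_compose[OF indep[OF i]]) auto
        then have "indep_var borel (indicator (E i) :: _ \<Rightarrow> real) borel (\<lambda>\<omega>. s ^ V i \<omega>)"
          by (simp add: comp_def id_def)
        then have "?b = expectation (indicator (E i)) * ?c"
          by (rule indep_var_lebesgue_integral) (use E i s in \<open>auto intro!: int_ind int_pow\<close>)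
        then show ?thesis
          using E[OF i] sets.sets_into_space[OF E[OF i]] by (simp add: Int_absorb2)
      qed
      have "?a - ?b = expectation (\<lambda>\<omega>. indicator (E i) \<omega> * s ^ (W \<omega> - 1) - indicator (E i) \<omega> * s ^ V i \<omega>)"
        by (rule Bochner_Integration.integral_diff[symmetric]) (auto intro!: int_ind_pow i s)
      also have "\<bar>\<dots>\<bar> \<le> expectation (\<lambda>\<omega>. \<Sum>j\<in>B i - {i}. indicator (E i \<inter> E j) \<omega>)"
      proof (rule order_trans[OF integral_abs_bound integral_mono])
        fix \<omega>
        show "\<bar>indicator (E i) \<omega> * s ^ (W \<omega> - 1) - indicator (E i) \<omega> * s ^ V i \<omega>\<bar>
            \<le> (\<Sum>j\<in>B i - {i}. indicator (E i \<inter> E j) \<omega>)"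
        proof (cases "\<omega> \<in> E i")
          case True
          have "{j \<in> B i. \<omega> \<in> E j} = insert i {j \<in> B i - {i}. \<omega> \<in> E j}"
            using True B(1)[OF i] by auto
          then have "W \<omega> - 1 = V i \<omega> + card {j \<in> B i - {i}. \<omega> \<in> E j}"
            unfolding W_split using finB[OF i] by simp
          then have "\<bar>s ^ (W \<omega> - 1) - s ^ V i \<omega>\<bar> \<le> real (card {j \<in> B i - {i}. \<omega> \<in> E j})"
            using abs_power_diff_le[OF s] by simp
          also have "\<dots> = (\<Sum>j\<in>B i - {i}. indicator (E i \<inter> E j) \<omega>)"
            using True finB[OF i] by (subst card_eq) (auto simp: indicator_def)
          finally show ?thesis
            using True by simp
        qed (simp add: sum_nonneg)
      qed (use i s E B(2)[OF i] in \<open>auto intro!: int_ind_pow Bochner_Integration.integrable_diff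
             integrable_abs Bochner_Integration.integrable_sum int_ind\<close>)
      also have "\<dots> = (\<Sum>j\<in>B i - {i}. prob (E i \<inter> E j))"
        using E i B(2)[OF i] sets.sets_into_space[OF E[OF i]]
        by (subst Bochner_Integration.integral_sum) (auto intro!: int_ind sum.cong arg_cong[of _ _ prob])
      finally have ab: "\<bar>?a - ?b\<bar> \<le> (\<Sum>j\<in>B i - {i}. prob (E i \<inter> E j))" .
      have "\<phi> s - ?c = expectation (\<lambda>\<omega>. s ^ W \<omega> - s ^ V i \<omega>)"
        unfolding \<phi>_def by (rule Bochner_Integration.integral_diff[symmetric]) (auto intro!: int_pow s)
      also have "\<bar>\<dots>\<bar> \<le> expectation (\<lambda>\<omega>. \<Sum>j\<in>B i. indicator (E j) \<omega>)"
      proof (rule order_trans[OF integral_abs_bound integral_mono])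
        fix \<omega>
        show "\<bar>s ^ W \<omega> - s ^ V i \<omega>\<bar> \<le> (\<Sum>j\<in>B i. indicator (E j) \<omega>)"
          using abs_power_diff_le[OF s, of "V i \<omega>" "card {j \<in> B i. \<omega> \<in> E j}"]
          unfolding W_split by (simp add: card_eq[OF finB[OF i]] real_ind)
      qed (use s E B(2)[OF i] in \<open>auto intro!: int_pow Bochner_Integration.integrable_diff
             integrable_abs Bochner_Integration.integrable_sum int_ind\<close>)
      also have "\<dots> = (\<Sum>j\<in>B i. prob (E j))"
        using E B(2)[OF i] sets.sets_into_space[OF E]
        by (subst Bochner_Integration.integral_sum) (auto intro!: int_ind sum.cong arg_cong[of _ _ prob])
      finally have "\<bar>prob (E i) * (\<phi> s - ?c)\<bar> \<le> prob (E i) * (\<Sum>j\<in>B i. prob (E j))"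
        unfolding abs_mult by (simp add: mult_left_mono)
      then show "\<bar>?a - prob (E i) * \<phi> s\<bar> \<le>
          (\<Sum>j\<in>B i. prob (E i) * prob (E j)) + (\<Sum>j\<in>B i - {i}. prob (E i \<inter> E j))"
        using ab unfolding b_eq by (simp add: sum_distrib_left algebra_simps)
    qed
    finally show ?thesis .
  qed

  define g where "g = (\<lambda>s. \<phi> s * exp (- \<Lambda> * s))"
  have "(g has_real_derivative (\<phi>' s - \<Lambda> * \<phi> s) * exp (- \<Lambda> * s)) (at s)" for s
    unfolding g_def by (rule derivative_eq_intros deriv refl)+ (simp add: algebra_simps)
  then obtain z where z: "0 < z" "z < 1" "g 1 - g 0 = (1 - 0) * ((\<phi>' z - \<Lambda> * \<phi> z) * exp (- \<Lambda> * z))"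
    using MVT2[of 0 1 g "\<lambda>s. (\<phi>' s - \<Lambda> * \<phi> s) * exp (- \<Lambda> * s)"] by auto
  have "\<Lambda> \<ge> 0"
    by (simp add: \<Lambda>_def sum_nonneg)
  have "\<bar>g 1 - g 0\<bar> = \<bar>\<phi>' z - \<Lambda> * \<phi> z\<bar> * exp (- \<Lambda> * z)"
    by (simp add: z abs_mult)
  also have "\<dots> \<le> \<bar>\<phi>' z - \<Lambda> * \<phi> z\<bar> * 1"
    using \<open>\<Lambda> \<ge> 0\<close> z by (intro mult_left_mono) auto
  also have "\<dots> \<le> ?\<delta>"
    using bound[of z] z by simp
  finally have "\<bar>g 1 - g 0\<bar> \<le> ?\<delta>" .
  moreover have "g 1 = exp (- \<Lambda>)"
    by (simp add: g_def \<phi>_def prob_space)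
  moreover have "g 0 = prob {\<omega> \<in> space M. \<forall>i\<in>I. \<omega> \<notin> E i}"
  proof -
    have "g 0 = expectation (\<lambda>\<omega>. (\<lambda>k. 0 ^ k) (W \<omega>))"
      by (simp add: g_def \<phi>_def)
    also have "\<dots> = (\<Sum>k\<le>card I. prob {\<omega> \<in> space M. W \<omega> = k} * 0 ^ k)"
      by (rule expectation_nat_eq_sum) (use W_le in auto)
    also have "\<dots> = (\<Sum>k\<in>{0}. prob {\<omega> \<in> space M. W \<omega> = k} * 0 ^ k)"
      by (rule sum.mono_neutral_right) auto
    also have "\<dots> = prob {\<omega> \<in> space M. W \<omega> = 0}"
      by simp
    also have "{\<omega> \<in> space M. W \<omega> = 0} = {\<omega> \<in> space M. \<forall>i\<in>I. \<omega> \<notin> E i}"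
      using fin by (auto simp: W_def card_eq_0_iff)
    finally show ?thesis by simp
  qed
  ultimately show ?thesis
    by (simp add: \<Lambda>_def abs_minus_commute)
qed

end

section \<open>Exceedances in a spherical sample\<close>

text \<open>
  Fubini's theorem for the product law of the independent \<open>A\<close> and \<open>Z\<close>, when the conditional
  probability given \<open>A\<close> is constant.
\<close>

lemma (in prob_space) prob_eq_of_constant_section:
  assumes indep: "indep_var S A T Z"
    and P: "{w \<in> space (S \<Otimes>\<^sub>M T). P (fst w) (snd w)} \<in> sets (S \<Otimes>\<^sub>M T)"
    and section_eq: "AE \<omega> in M. prob {\<omega>' \<in> space M. P (A \<omega>) (Z \<omega>')} = c"
  shows "prob {\<omega> \<in> space M. P (A \<omega>) (Z \<omega>)} = c"
proof -
  define D where "D = {w \<in> space (S \<Otimes>\<^sub>M T). P (fst w) (snd w)}"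
  have D [measurable]: "D \<in> sets (S \<Otimes>\<^sub>M T)"
    using P unfolding D_def .
  have AZ [measurable]: "A \<in> measurable M S" "Z \<in> measurable M T"
    and joint: "distr M S A \<Otimes>\<^sub>M distr M T Z = distr M (S \<Otimes>\<^sub>M T) (\<lambda>\<omega>. (A \<omega>, Z \<omega>))"
    using indep unfolding indep_var_distribution_eq by auto
  interpret Z: prob_space "distr M T Z"
    by (rule prob_space_distr) measurable
  have sp: "A \<omega> \<in> space S" "Z \<omega> \<in> space T" if "\<omega> \<in> space M" for \<omega>
    using measurable_space[OF AZ(1) that] measurable_space[OF AZ(2) that] .
  have "{\<omega> \<in> space M. P (A \<omega>) (Z \<omega>)} = (\<lambda>\<omega>. (A \<omega>, Z \<omega>)) -` D \<inter> space M"
    by (auto simp: D_def space_pair_measure sp)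
  then have "emeasure M {\<omega> \<in> space M. P (A \<omega>) (Z \<omega>)} = emeasure (distr M (S \<Otimes>\<^sub>M T) (\<lambda>\<omega>. (A \<omega>, Z \<omega>))) D"
    by (subst emeasure_distr) simp_all
  also have "\<dots> = (\<integral>\<^sup>+ a. emeasure (distr M T Z) (Pair a -` D) \<partial>distr M S A)"
    unfolding joint[symmetric] by (rule Z.emeasure_pair_measure_alt) simp
  also have "\<dots> = (\<integral>\<^sup>+ \<omega>. emeasure (distr M T Z) (Pair (A \<omega>) -` D) \<partial>M)"
  proof (rule nn_integral_distr)
    have "D \<in> sets (S \<Otimes>\<^sub>M distr M T Z)"
      by simp
    from Z.measurable_emeasure_Pair[OF this]
    show "(\<lambda>a. emeasure (distr M T Z) (Pair a -` D)) \<in> borel_measurable (distr M S A)"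
      by simp
  qed measurable
  also have "\<dots> = (\<integral>\<^sup>+ \<omega>. ennreal c \<partial>M)"
  proof (rule nn_integral_cong_AE)
    show "AE \<omega> in M. emeasure (distr M T Z) (Pair (A \<omega>) -` D) = ennreal c"
      using section_eq AE_space
    proof eventually_elim
      case (elim \<omega>)
      have "Pair (A \<omega>) -` D \<in> sets T"
        using D by (rule sets_Pair1)
      then have "emeasure (distr M T Z) (Pair (A \<omega>) -` D) = emeasure M (Z -` (Pair (A \<omega>) -` D) \<inter> space M)"
        by (simp add: emeasure_distr)
      also have "Z -` (Pair (A \<omega>) -` D) \<inter> space M = {\<omega>' \<in> space M. P (A \<omega>) (Z \<omega>')}"
        using sp elim(2) by (auto simp: D_def space_pair_measure)
      finally show ?case
        using elim(1) by (simp add: emeasure_eq_measure)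
    qed
  qed
  also have "\<dots> = ennreal c"
    by (simp add: emeasure_space_1)
  finally have eq: "ennreal (prob {\<omega> \<in> space M. P (A \<omega>) (Z \<omega>)}) = ennreal c"
    by (simp add: emeasure_eq_measure)
  have "c \<ge> 0"
  proof -
    from section_eq have "AE \<omega> in M. c \<ge> 0"
      by eventually_elim (auto intro: measure_nonneg)
    then show ?thesis by simp
  qed
  with eq show ?thesis by simp
qed

text \<open>
  Needed because the indicator of an event vanishes outside the space, where a function of the
  sample may take other values.
\<close>

lemma (in prob_space) indep_var_cong_space:
  assumes "indep_var S X T Y" "\<And>\<omega>. \<omega> \<in> space M \<Longrightarrow> X \<omega> = X' \<omega>" "\<And>\<omega>. \<omega> \<in> space M \<Longrightarrow> Y \<omega> = Y' \<omega>"
  shows "indep_var S X' T Y'"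
  using assms unfolding indep_var_distribution_eq
  by (simp cong: measurable_cong distr_cong)

lemma pearson_measurable [measurable (raw)]:
  assumes f: "f \<in> measurable M (Rn n)" and g: "g \<in> measurable M (Rn n)"
  shows "(\<lambda>x. pearson n (f x) (g x)) \<in> borel_measurable M"
proof -
  have "(\<lambda>x. centered_dir n (h x) i) \<in> borel_measurable M" if "i \<in> {1..n}" "h \<in> measurable M (Rn n)" for h i
    using measurable_compose[OF that(2) centered_dir_measurable[OF that(1)]] .
  then show ?thesis
    unfolding pearson_eq_dot dot_def using f g by (intro borel_measurable_sum borel_measurable_times)
qed

lemma pearson_commute: "pearson n x y = pearson n y x"
  unfolding pearson_eq_dot by (rule dot_commute)

locale spherical_sample = prob_space M for M :: "'a measure" +
  fixes n p :: nat and X :: "nat \<Rightarrow> 'a \<Rightarrow> nat \<Rightarrow> real" and N :: "(nat \<Rightarrow> real) measure"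
  assumes dim: "n \<ge> 4"
    and indep: "indep_vars (\<lambda>_. Rn n) X {1..p}"
    and law: "\<And>k. k \<in> {1..p} \<Longrightarrow> distr M (Rn n) (X k) = N"
    and spherical: "spherical_law N n"
begin

sublocale N: spherical_law N n
  by (rule spherical)

lemma X_measurable: "k \<in> {1..p} \<Longrightarrow> X k \<in> measurable M (Rn n)"
  using indep by (simp add: indep_vars_def2)

text \<open>
  The law of the correlation of \<open>X j\<close> with a fixed vector \<open>x\<close> is the same for all nonconstant \<open>x\<close>. This is
  what makes exceedances that share an index independent.
\<close>

lemma prob_section:
  assumes j: "j \<in> {1..p}" and x: "\<not> (\<forall>i\<in>{1..n}. x i = mean n x)"
  shows "prob {\<omega> \<in> space M. t \<le> \<bar>pearson n x (X j \<omega>)\<bar>} = corr_tail (n - 4) t"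
proof -
  note [measurable] = X_measurable[OF j]
  let ?f = "\<lambda>y. dot n (centered_dir n x) (centered_dir n y)"
  have u: "dot n (centered_dir n x) (centered_dir n x) = 1" "dot n (centered_dir n x) (\<lambda>_. 1) = 0"
    using x dim dot_one_centered_dir[of n x] by (auto simp: dot_centered_dir_self dot_commute)
  have "corr_law (n - 4) = distr (distr M (Rn n) (X j)) borel ?f"
    unfolding law[OF j] by (rule N.distr_dot_centered_dir_eq_corr_law[OF dim u, symmetric])
  also have "\<dots> = distr M borel (\<lambda>\<omega>. ?f (X j \<omega>))"
    by (subst distr_distr) (simp_all add: comp_def X_measurable[OF j])
  finally have "corr_tail (n - 4) t = measure (distr M borel (\<lambda>\<omega>. ?f (X j \<omega>))) {r. t \<le> \<bar>r\<bar>}"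
    by (simp add: corr_tail_def)
  also have "\<dots> = prob ((\<lambda>\<omega>. ?f (X j \<omega>)) -` {r. t \<le> \<bar>r\<bar>} \<inter> space M)"
    by (rule measure_distr[OF measurable_compose[OF X_measurable[OF j] dot_centered_dir_measurable]]) measurable
  also have "(\<lambda>\<omega>. ?f (X j \<omega>)) -` {r. t \<le> \<bar>r\<bar>} \<inter> space M = {\<omega> \<in> space M. t \<le> \<bar>pearson n x (X j \<omega>)\<bar>}"
    by (auto simp: pearson_eq_dot)
  finally show ?thesis by simp
qed

lemma AE_sample_not_constant:
  assumes i: "i \<in> {1..p}"
  shows "AE \<omega> in M. \<not> (\<forall>k\<in>{1..n}. X i \<omega> k = mean n (X i \<omega>))"
proof -
  have "AE y in distr M (Rn n) (X i). \<not> (\<forall>k\<in>{1..n}. y k = mean n y)"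
    unfolding law[OF i] by (rule N.AE_not_constant)
  then show ?thesis
    by (rule AE_distrD[OF X_measurable[OF i]])
qed

definition corr_event :: "real \<Rightarrow> nat \<Rightarrow> nat \<Rightarrow> 'a set" where
  "corr_event t i j = {\<omega> \<in> space M. t \<le> \<bar>pearson n (X i \<omega>) (X j \<omega>)\<bar>}"

lemma corr_event_commute: "corr_event t i j = corr_event t j i"
  by (simp add: corr_event_def pearson_commute)

lemma corr_event_sets: "i \<in> {1..p} \<Longrightarrow> j \<in> {1..p} \<Longrightarrow> corr_event t i j \<in> events"
  using pearson_measurable[OF X_measurable X_measurable, of i j] unfolding corr_event_def by measurable

lemma pearson_component_measurable:
  assumes "a \<in> J" "b \<in> K"
  shows "(\<lambda>w. pearson n (fst w a) (snd w b)) \<in> borel_measurable (PiM J (\<lambda>_. Rn n) \<Otimes>\<^sub>M PiM K (\<lambda>_. Rn n))"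
  by (rule pearson_measurable[OF measurable_compose[OF measurable_fst measurable_component_singleton[OF assms(1)]]
      measurable_compose[OF measurable_snd measurable_component_singleton[OF assms(2)]]])

lemma prob_corr_event:
  assumes ij: "i \<in> {1..p}" "j \<in> {1..p}" "i \<noteq> j"
  shows "prob (corr_event t i j) = corr_tail (n - 4) t"
proof -
  let ?r = "\<lambda>A \<omega>. restrict (\<lambda>k. X k \<omega>) A"
  have "prob {\<omega> \<in> space M. t \<le> \<bar>pearson n (?r {i} \<omega> i) (?r {j} \<omega> j)\<bar>} = corr_tail (n - 4) t"
  proof (rule prob_eq_of_constant_section[where A = "?r {i}" and Z = "?r {j}" and
      P = "\<lambda>a z. t \<le> \<bar>pearson n (a i) (z j)\<bar>"])
    show "indep_var (PiM {i} (\<lambda>_. Rn n)) (?r {i}) (PiM {j} (\<lambda>_. Rn n)) (?r {j})"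
      using ij by (intro indep_var_restrict[OF indep]) auto
    have [measurable]: "(\<lambda>w. pearson n (fst w i) (snd w j)) \<in>
        borel_measurable (PiM {i} (\<lambda>_. Rn n) \<Otimes>\<^sub>M PiM {j} (\<lambda>_. Rn n))"
      by (rule pearson_component_measurable) simp_all
    show "{w \<in> space (PiM {i} (\<lambda>_. Rn n) \<Otimes>\<^sub>M PiM {j} (\<lambda>_. Rn n)). t \<le> \<bar>pearson n (fst w i) (snd w j)\<bar>} \<in>
        sets (PiM {i} (\<lambda>_. Rn n) \<Otimes>\<^sub>M PiM {j} (\<lambda>_. Rn n))"
      by measurable
    show "AE \<omega> in M. prob {\<omega>' \<in> space M. t \<le> \<bar>pearson n (?r {i} \<omega> i) (?r {j} \<omega>' j)\<bar>} = corr_tail (n - 4) t"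
      using AE_sample_not_constant[OF ij(1)] by eventually_elim (simp add: prob_section[OF ij(2)])
  qed
  then show ?thesis
    by (simp add: corr_event_def)
qed

text \<open>
  Given \<open>X i\<close>, the two events are independent with probabilities that do not depend on \<open>X i\<close>.
\<close>

lemma prob_corr_event_Int:
  assumes ijk: "i \<in> {1..p}" "j \<in> {1..p}" "k \<in> {1..p}" "i \<noteq> j" "i \<noteq> k" "j \<noteq> k"
  shows "prob (corr_event t i j \<inter> corr_event t i k) = (corr_tail (n - 4) t)\<^sup>2"
proof -
  let ?r = "\<lambda>A \<omega>. restrict (\<lambda>k. X k \<omega>) A"
  let ?S = "PiM {i} (\<lambda>_. Rn n) \<Otimes>\<^sub>M PiM {j, k} (\<lambda>_. Rn n)"
  have split: "prob {\<omega>' \<in> space M. t \<le> \<bar>pearson n x (X j \<omega>')\<bar> \<and> t \<le> \<bar>pearson n x (X k \<omega>')\<bar>} =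
      prob {\<omega>' \<in> space M. t \<le> \<bar>pearson n x (X j \<omega>')\<bar>} * prob {\<omega>' \<in> space M. t \<le> \<bar>pearson n x (X k \<omega>')\<bar>}" for x
  proof -
    have m: "(\<lambda>y. pearson n x y) \<in> borel_measurable (Rn n)"
      unfolding pearson_eq_dot by measurable
    then have S: "{y \<in> space (Rn n). t \<le> \<bar>pearson n x y\<bar>} \<in> sets (Rn n)"
      by measurable
    have sp: "X a \<omega> \<in> space (Rn n)" if "a \<in> {1..p}" "\<omega> \<in> space M" for a \<omega>
      using measurable_space[OF X_measurable] that by blast
    have "indep_var (PiM {j} (\<lambda>_. Rn n)) (?r {j}) (PiM {k} (\<lambda>_. Rn n)) (?r {k})"
      using ijk by (intro indep_var_restrict[OF indep]) auto
    then have "indep_var (Rn n) ((\<lambda>w. w j) \<circ> ?r {j}) (Rn n) ((\<lambda>w. w k) \<circ> ?r {k})"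
      by (rule indep_var_compose) (rule measurable_component_singleton, simp)+
    then have "indep_var (Rn n) (X j) (Rn n) (X k)"
      by (simp add: comp_def)
    note prod = indep_varD[OF this S S]
    have both: "(\<lambda>\<omega>. (X j \<omega>, X k \<omega>)) -` ({y \<in> space (Rn n). t \<le> \<bar>pearson n x y\<bar>} \<times>
        {y \<in> space (Rn n). t \<le> \<bar>pearson n x y\<bar>}) \<inter> space M =
        {\<omega>' \<in> space M. t \<le> \<bar>pearson n x (X j \<omega>')\<bar> \<and> t \<le> \<bar>pearson n x (X k \<omega>')\<bar>}"
      using sp[OF ijk(2)] sp[OF ijk(3)] by blast
    have single: "X a -` {y \<in> space (Rn n). t \<le> \<bar>pearson n x y\<bar>} \<inter> space M =
        {\<omega>' \<in> space M. t \<le> \<bar>pearson n x (X a \<omega>')\<bar>}" if "a \<in> {1..p}" for a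
      using sp[OF that] by blast
    show ?thesis
      using prod unfolding both single[OF ijk(2)] single[OF ijk(3)] .
  qed
  have "prob {\<omega> \<in> space M. t \<le> \<bar>pearson n (?r {i} \<omega> i) (?r {j, k} \<omega> j)\<bar> \<and>
      t \<le> \<bar>pearson n (?r {i} \<omega> i) (?r {j, k} \<omega> k)\<bar>} = (corr_tail (n - 4) t)\<^sup>2"
  proof (rule prob_eq_of_constant_section[where A = "?r {i}" and Z = "?r {j, k}" and
      P = "\<lambda>a z. t \<le> \<bar>pearson n (a i) (z j)\<bar> \<and> t \<le> \<bar>pearson n (a i) (z k)\<bar>"])
    show "indep_var (PiM {i} (\<lambda>_. Rn n)) (?r {i}) (PiM {j, k} (\<lambda>_. Rn n)) (?r {j, k})"
      using ijk by (intro indep_var_restrict[OF indep]) auto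
    have [measurable]: "(\<lambda>w. pearson n (fst w i) (snd w j)) \<in> borel_measurable ?S"
        "(\<lambda>w. pearson n (fst w i) (snd w k)) \<in> borel_measurable ?S"
      by (rule pearson_component_measurable; simp)+
    show "{w \<in> space ?S. t \<le> \<bar>pearson n (fst w i) (snd w j)\<bar> \<and> t \<le> \<bar>pearson n (fst w i) (snd w k)\<bar>} \<in> sets ?S"
      by measurable
    show "AE \<omega> in M. prob {\<omega>' \<in> space M. t \<le> \<bar>pearson n (?r {i} \<omega> i) (?r {j, k} \<omega>' j)\<bar> \<and>
        t \<le> \<bar>pearson n (?r {i} \<omega> i) (?r {j, k} \<omega>' k)\<bar>} = (corr_tail (n - 4) t)\<^sup>2"
      using AE_sample_not_constant[OF ijk(1)]
    proof eventually_elim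
      case (elim \<omega>)
      then show ?case
        by (simp add: split prob_section[OF ijk(2)] prob_section[OF ijk(3)] power2_eq_square)
    qed
  qed
  moreover have "corr_event t i j \<inter> corr_event t i k =
      {\<omega> \<in> space M. t \<le> \<bar>pearson n (?r {i} \<omega> i) (?r {j, k} \<omega> j)\<bar> \<and>
        t \<le> \<bar>pearson n (?r {i} \<omega> i) (?r {j, k} \<omega> k)\<bar>}"
    by (auto simp: corr_event_def)
  ultimately show ?thesis by simp
qed

text \<open>
  Putting the larger index first makes the size an arithmetic series.
\<close>

definition pairs :: "(nat \<times> nat) set" where
  "pairs = (SIGMA j:{1..p}. {1..<j})"

lemma finite_pairs: "finite pairs"
  by (simp add: pairs_def)

lemma card_pairs: "real (card pairs) = real p * (real p - 1) / 2"
proof -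
  have "card pairs = (\<Sum>j=1..p. j - 1)"
    by (simp add: pairs_def)
  moreover have "real (\<Sum>j=1..p. j - 1) = real p * (real p - 1) / 2" for p :: nat
    by (induction p) (auto simp: field_simps)
  ultimately show ?thesis by simp
qed

text \<open>
  The neighbourhood of a pair consists of the pairs that share an index with it; there are at most
  \<open>4 p\<close> of them. Both kinds of terms in the error bound equal \<open>q\<^sup>2\<close>, and there are at most \<open>p\<^sup>2 / 2\<close> pairs.
\<close>

lemma no_corr_event_approx:
  "\<bar>prob {\<omega> \<in> space M. \<forall>(j, i)\<in>pairs. \<omega> \<notin> corr_event t j i} - exp (- (real p * (real p - 1) / 2 * corr_tail (n - 4) t))\<bar>
    \<le> 4 * real p ^ 3 * (corr_tail (n - 4) t)\<^sup>2"
proof -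
  define q where "q = corr_tail (n - 4) t"
  define E where "E = (\<lambda>(j, i). corr_event t j i)"
  define B where "B = (\<lambda>(j, i). {(b, a) \<in> pairs. {b, a} \<inter> {j, i} \<noteq> {}})"
  have E_sets: "E \<alpha> \<in> events" if "\<alpha> \<in> pairs" for \<alpha>
    using that by (auto simp: E_def pairs_def intro!: corr_event_sets)
  have E_prob: "prob (E \<alpha>) = q" if "\<alpha> \<in> pairs" for \<alpha>
    using that by (auto simp: E_def pairs_def q_def intro!: prob_corr_event)
  have E_Int: "prob (E \<alpha> \<inter> E \<beta>) = q\<^sup>2" if "\<alpha> \<in> pairs" "\<beta> \<in> B \<alpha> - {\<alpha>}" for \<alpha> \<beta>
  proof -
    obtain j i b a where [simp]: "\<alpha> = (j, i)" "\<beta> = (b, a)"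
      by (cases \<alpha>; cases \<beta>)
    have ji: "i < j" "i \<in> {1..p}" "j \<in> {1..p}" and ba: "a < b" "a \<in> {1..p}" "b \<in> {1..p}"
      and ne: "(b, a) \<noteq> (j, i)" and "b = j \<or> b = i \<or> a = j \<or> a = i"
      using that by (auto simp: B_def pairs_def)
    then consider "b = j" "a \<noteq> i" | "b = i" | "a = j" | "a = i" "b \<noteq> j"
      by auto
    then show ?thesis
    proof cases
      case 1
      then show ?thesis
        using prob_corr_event_Int[of j i a t] ji ba by (simp add: E_def q_def)
    next
      case 2
      then show ?thesis
        using prob_corr_event_Int[of i j a t] ji ba
        by (simp add: E_def q_def corr_event_commute[of t j i])
    next
      case 3
      then show ?thesis
        using prob_corr_event_Int[of j i b t] ji ba
        by (simp add: E_def q_def corr_event_commute[of t b j])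
    next
      case 4
      then show ?thesis
        using prob_corr_event_Int[of i j b t] ji ba
        by (simp add: E_def q_def corr_event_commute[of t _ i])
    qed
  qed
  have B_card: "real (card (B \<alpha>)) \<le> 4 * real p" for \<alpha>
  proof -
    obtain j i where \<alpha>: "\<alpha> = (j, i)" by (cases \<alpha>)
    have "B \<alpha> \<subseteq> {j, i} \<times> {1..p} \<union> {1..p} \<times> {j, i}"
      by (auto simp: B_def pairs_def \<alpha>)
    then have "card (B \<alpha>) \<le> card ({j, i} \<times> {1..p} \<union> {1..p} \<times> {j, i})"
      by (intro card_mono) auto
    also have "\<dots> \<le> card ({j, i} \<times> {1..p}) + card ({1..p} \<times> {j, i})"
      by (rule card_Un_le)
    also have "\<dots> = card {j, i} * p + p * card {j, i}"
      by (simp add: card_cartesian_product)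
    also have "\<dots> \<le> 2 * p + p * 2"
      by (intro add_mono mult_mono) (auto simp: card_insert_if)
    finally show ?thesis by simp
  qed
  have B_sub: "B \<alpha> \<subseteq> pairs" for \<alpha>
    by (auto simp: B_def)
  have B_fin: "finite (B \<alpha>)" for \<alpha>
    using B_sub finite_pairs by (rule finite_subset)
  have "\<bar>prob {\<omega> \<in> space M. \<forall>\<alpha>\<in>pairs. \<omega> \<notin> E \<alpha>} - exp (- (\<Sum>\<alpha>\<in>pairs. prob (E \<alpha>)))\<bar> \<le>
      (\<Sum>\<alpha>\<in>pairs. (\<Sum>\<beta>\<in>B \<alpha>. prob (E \<alpha>) * prob (E \<beta>)) + (\<Sum>\<beta>\<in>B \<alpha> - {\<alpha>}. prob (E \<alpha> \<inter> E \<beta>)))"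
  proof (rule void_probability_close_to_exp)
    fix \<alpha> assume \<alpha>: "\<alpha> \<in> pairs"
    show "\<alpha> \<in> B \<alpha>"
      using \<alpha> by (auto simp: B_def)
    obtain j i where ji: "\<alpha> = (j, i)" by (cases \<alpha>)
    \<comment> \<open>Events outside the neighbourhood depend only on the vectors with index in \<open>J\<close>.\<close>
    define J where "J = {1..p} - {j, i}"
    have sub: "{j, i} \<subseteq> {1..p}"
      using \<alpha> by (auto simp: ji pairs_def)
    let ?r = "\<lambda>A \<omega>. restrict (\<lambda>k. X k \<omega>) A"
    let ?f = "\<lambda>w. of_bool (t \<le> \<bar>pearson n (w j) (w i)\<bar>) :: real"
    let ?g = "\<lambda>w. \<Sum>(b, a)\<in>pairs - B \<alpha>. of_bool (t \<le> \<bar>pearson n (w b) (w a)\<bar>) :: real"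
    have comp: "(\<lambda>w. of_bool (t \<le> \<bar>pearson n (w b) (w a)\<bar>) :: real) \<in> borel_measurable (PiM K (\<lambda>_. Rn n))"
      if "b \<in> K" "a \<in> K" for a b K
    proof -
      have [measurable]: "(\<lambda>w. pearson n (w b) (w a)) \<in> borel_measurable (PiM K (\<lambda>_. Rn n))"
        using that by (intro pearson_measurable measurable_component_singleton)
      show ?thesis
        unfolding of_bool_def by measurable
    qed
    have far: "b \<in> J \<and> a \<in> J" if "(b, a) \<in> pairs - B \<alpha>" for b a
      using that by (auto simp: B_def ji J_def pairs_def)
    have "indep_var (PiM {j, i} (\<lambda>_. Rn n)) (?r {j, i}) (PiM J (\<lambda>_. Rn n)) (?r J)"
      using sub by (intro indep_var_restrict[OF indep]) (auto simp: J_def)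
    then have "indep_var borel (?f \<circ> ?r {j, i}) borel (?g \<circ> ?r J)"
    proof (rule indep_var_compose)
      show "?f \<in> borel_measurable (PiM {j, i} (\<lambda>_. Rn n))"
        by (rule comp) simp_all
      show "?g \<in> borel_measurable (PiM J (\<lambda>_. Rn n))"
        using far by (intro borel_measurable_sum) (auto intro!: comp)
    qed
    then show "indep_var borel (indicator (E \<alpha>)) borel (\<lambda>\<omega>. real (card {\<beta> \<in> pairs - B \<alpha>. \<omega> \<in> E \<beta>}))"
    proof (rule indep_var_cong_space)
      fix \<omega> assume \<omega>: "\<omega> \<in> space M"
      show "(?f \<circ> ?r {j, i}) \<omega> = indicator (E \<alpha>) \<omega>"
        using \<omega> by (simp add: E_def ji corr_event_def indicator_def)
      have "real (card {\<beta> \<in> pairs - B \<alpha>. \<omega> \<in> E \<beta>}) = (\<Sum>\<beta>\<in>pairs - B \<alpha>. of_bool (\<omega> \<in> E \<beta>))"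
        using finite_pairs by (simp add: of_bool_def sum.If_cases Int_def)
      also have "\<dots> = (?g \<circ> ?r J) \<omega>"
        unfolding comp_def using far \<omega> by (intro sum.cong refl) (auto simp: E_def corr_event_def)
      finally show "(?g \<circ> ?r J) \<omega> = real (card {\<beta> \<in> pairs - B \<alpha>. \<omega> \<in> E \<beta>})" ..
    qed
  qed (use finite_pairs E_sets B_sub in auto)
  also have "\<dots> = (\<Sum>\<alpha>\<in>pairs. real (card (B \<alpha>)) * q\<^sup>2 + real (card (B \<alpha> - {\<alpha>})) * q\<^sup>2)"
  proof (rule sum.cong[OF refl], rule arg_cong2[of _ _ _ _ "(+)"])
    fix \<alpha> assume \<alpha>: "\<alpha> \<in> pairs"
    have "(\<Sum>\<beta>\<in>B \<alpha>. prob (E \<alpha>) * prob (E \<beta>)) = (\<Sum>\<beta>\<in>B \<alpha>. q\<^sup>2)"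
      by (rule sum.cong[OF refl]) (simp add: E_prob[OF \<alpha>] E_prob[OF subsetD[OF B_sub]] power2_eq_square)
    then show "(\<Sum>\<beta>\<in>B \<alpha>. prob (E \<alpha>) * prob (E \<beta>)) = real (card (B \<alpha>)) * q\<^sup>2"
      by simp
    have "(\<Sum>\<beta>\<in>B \<alpha> - {\<alpha>}. prob (E \<alpha> \<inter> E \<beta>)) = (\<Sum>\<beta>\<in>B \<alpha> - {\<alpha>}. q\<^sup>2)"
      by (rule sum.cong[OF refl]) (rule E_Int[OF \<alpha>])
    then show "(\<Sum>\<beta>\<in>B \<alpha> - {\<alpha>}. prob (E \<alpha> \<inter> E \<beta>)) = real (card (B \<alpha> - {\<alpha>})) * q\<^sup>2"
      by simp
  qed
  also have "\<dots> \<le> (\<Sum>\<alpha>\<in>pairs. 4 * real p * q\<^sup>2 + 4 * real p * q\<^sup>2)"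
  proof (rule sum_mono, rule add_mono)
    fix \<alpha>
    show "real (card (B \<alpha>)) * q\<^sup>2 \<le> 4 * real p * q\<^sup>2"
      by (rule mult_right_mono[OF B_card]) simp
    have "real (card (B \<alpha> - {\<alpha>})) \<le> real (card (B \<alpha>))"
      using B_fin by (intro of_nat_mono card_mono) auto
    then show "real (card (B \<alpha> - {\<alpha>})) * q\<^sup>2 \<le> 4 * real p * q\<^sup>2"
      using B_card[of \<alpha>] by (intro mult_right_mono) auto
  qed
  also have "\<dots> = real p * (real p - 1) / 2 * (8 * real p * q\<^sup>2)"
    by (simp add: card_pairs)
  also have "\<dots> \<le> real p * real p / 2 * (8 * real p * q\<^sup>2)"
    by (intro mult_right_mono divide_right_mono mult_left_mono) auto
  also have "\<dots> = 4 * real p ^ 3 * q\<^sup>2"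
    by (simp add: power3_eq_cube)
  finally have "\<bar>prob {\<omega> \<in> space M. \<forall>\<alpha>\<in>pairs. \<omega> \<notin> E \<alpha>} - exp (- (\<Sum>\<alpha>\<in>pairs. prob (E \<alpha>)))\<bar> \<le> 4 * real p ^ 3 * q\<^sup>2" .
  moreover have "(\<Sum>\<alpha>\<in>pairs. prob (E \<alpha>)) = real p * (real p - 1) / 2 * q"
    by (simp add: E_prob card_pairs)
  moreover have "(\<forall>\<alpha>\<in>pairs. \<omega> \<notin> E \<alpha>) = (\<forall>(j, i)\<in>pairs. \<omega> \<notin> corr_event t j i)" for \<omega>
    by (auto simp: E_def)
  ultimately show ?thesis
    by (simp add: q_def)
qed

lemma prob_some_corr_event_le:
  "prob {\<omega> \<in> space M. \<exists>(j, i)\<in>pairs. \<omega> \<in> corr_event t j i} \<le> (real p)\<^sup>2 * corr_tail (n - 4) t"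
proof -
  have sets: "corr_event t j i \<in> events" if "(j, i) \<in> pairs" for j i
    using that by (auto simp: pairs_def intro!: corr_event_sets)
  have "{\<omega> \<in> space M. \<exists>(j, i)\<in>pairs. \<omega> \<in> corr_event t j i} = (\<Union>(j, i)\<in>pairs. corr_event t j i)"
    by (auto simp: corr_event_def)
  also have "prob \<dots> \<le> (\<Sum>(j, i)\<in>pairs. prob (corr_event t j i))"
    using finite_measure_subadditive_finite[OF finite_pairs, of "\<lambda>(j, i). corr_event t j i"] sets
    by (simp add: case_prod_unfold image_subset_iff)
  also have "\<dots> = (\<Sum>(j, i)\<in>pairs. corr_tail (n - 4) t)"
    by (intro sum.cong refl) (auto simp: pairs_def intro!: prob_corr_event)
  also have "\<dots> = real p * (real p - 1) / 2 * corr_tail (n - 4) t"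
    by (simp add: card_pairs case_prod_unfold)
  also have "\<dots> \<le> (real p)\<^sup>2 * corr_tail (n - 4) t"
    by (intro mult_right_mono) (auto simp: corr_tail_def power2_eq_square field_simps)
  finally show ?thesis .
qed

end

section \<open>The maximal correlation coefficient\<close>

lemma spherical_law_distr:
  assumes "prob_space M" "n \<ge> 2" "spherical M n Y"
    and null: "measure M {\<omega> \<in> space M. \<forall>i\<in>{1..n}. Y \<omega> i = 0} = 0"
  shows "spherical_law (distr M (Rn n) Y) n"
proof -
  interpret prob_space M by fact
  have Y [measurable]: "Y \<in> measurable M (Rn n)"
    and rot: "\<And>Q. orthogonal_entries n Q \<Longrightarrow> distr M (Rn n) (\<lambda>\<omega>. matvec n Q (Y \<omega>)) = distr M (Rn n) Y"
    using assms(3) by (auto simp: spherical_def)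
  interpret Y: prob_space "distr M (Rn n) Y"
    by (rule prob_space_distr) fact
  show ?thesis
  proof
    show "distr (distr M (Rn n) Y) (Rn n) (matvec n Q) = distr M (Rn n) Y" if "orthogonal_entries n Q" for Q
      using rot[OF that] by (subst distr_distr) (simp_all add: comp_def)
    have "{y \<in> space (Rn n). \<forall>i\<in>{1..n}. y i = 0} \<in> sets (Rn n)"
      by (intro sets.sets_Collect_finite_All finite_atLeastAtMost; measurable)
    then have "measure (distr M (Rn n) Y) {y \<in> space (Rn n). \<forall>i\<in>{1..n}. y i = 0} =
        prob (Y -` {y \<in> space (Rn n). \<forall>i\<in>{1..n}. y i = 0} \<inter> space M)"
      by (rule measure_distr[OF Y])
    also have "Y -` {y \<in> space (Rn n). \<forall>i\<in>{1..n}. y i = 0} \<inter> space M = {\<omega> \<in> space M. \<forall>i\<in>{1..n}. Y \<omega> i = 0}"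
      using measurable_space[OF Y] by blast
    finally show "measure (distr M (Rn n) Y) {y \<in> space (distr M (Rn n) Y). \<forall>i\<in>{1..n}. y i = 0} = 0"
      using null by simp
  qed (use assms in simp_all)
qed

context spherical_sample
begin

abbreviation max_corr :: "'a \<Rightarrow> real" where
  "max_corr \<omega> \<equiv> max_abs_corr n p (\<lambda>k. X k \<omega>)"

lemma max_corr_eq_Max: "max_corr \<omega> = Max ((\<lambda>(j, i). \<bar>pearson n (X i \<omega>) (X j \<omega>)\<bar>) ` pairs)"
  unfolding max_abs_corr_def by (rule arg_cong[of _ _ Max]) (force simp: pairs_def)

lemma max_corr_measurable: "max_corr \<in> borel_measurable M"
  unfolding max_corr_eq_Max
  using X_measurable by (intro borel_measurable_Max finite_pairs)
    (auto simp: pairs_def intro!: borel_measurable_abs pearson_measurable)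

context
  assumes p: "p \<ge> 2"
begin

lemma pairs_nonempty: "pairs \<noteq> {}"
proof -
  have "(2, 1) \<in> pairs" using p by (simp add: pairs_def)
  then show ?thesis by blast
qed

lemma max_corr_ge_iff:
  assumes "\<omega> \<in> space M"
  shows "t \<le> max_corr \<omega> \<longleftrightarrow> (\<exists>(j, i)\<in>pairs. \<omega> \<in> corr_event t j i)"
proof -
  have "t \<le> max_corr \<omega> \<longleftrightarrow> (\<exists>(j, i)\<in>pairs. t \<le> \<bar>pearson n (X i \<omega>) (X j \<omega>)\<bar>)"
    unfolding max_corr_eq_Max using finite_pairs pairs_nonempty
    by (subst Max_ge_iff) (auto simp: case_prod_unfold)
  then show ?thesis
    using assms by (simp add: corr_event_def pearson_commute[of n "X (fst x) \<omega>" for x] case_prod_unfold)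
qed

lemma max_corr_bounds: "0 \<le> max_corr \<omega>" "max_corr \<omega> \<le> 1"
proof -
  have "max_corr \<omega> \<in> (\<lambda>(j, i). \<bar>pearson n (X i \<omega>) (X j \<omega>)\<bar>) ` pairs"
    unfolding max_corr_eq_Max using finite_pairs pairs_nonempty by (intro Max_in) auto
  then show "0 \<le> max_corr \<omega>" "max_corr \<omega> \<le> 1"
    by (auto simp: abs_pearson_le_1)
qed

lemma max_corr_ge_set:
  "{\<omega> \<in> space M. t \<le> max_corr \<omega>} = {\<omega> \<in> space M. \<exists>(j, i)\<in>pairs. \<omega> \<in> corr_event t j i}"
  using max_corr_ge_iff by blast

lemma prob_max_corr_ge_le: "prob {\<omega> \<in> space M. t \<le> max_corr \<omega>} \<le> (real p)\<^sup>2 * corr_tail (n - 4) t"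
  unfolding max_corr_ge_set by (rule prob_some_corr_event_le)

lemma prob_max_corr_ge_approx:
  "\<bar>prob {\<omega> \<in> space M. t \<le> max_corr \<omega>} - (1 - exp (- (real p * (real p - 1) / 2 * corr_tail (n - 4) t)))\<bar>
    \<le> 4 * real p ^ 3 * (corr_tail (n - 4) t)\<^sup>2"
proof -
  note [measurable] = max_corr_measurable
  have "{\<omega> \<in> space M. \<forall>(j, i)\<in>pairs. \<omega> \<notin> corr_event t j i} = {\<omega> \<in> space M. \<not> t \<le> max_corr \<omega>}"
    using max_corr_ge_iff by blast
  also have "prob \<dots> = 1 - prob {\<omega> \<in> space M. t \<le> max_corr \<omega>}"
    by (rule prob_neg) measurable
  finally show ?thesis
    using no_corr_event_approx[of t] by linarith
qed

lemma AE_max_corr_less_1: "AE \<omega> in M. max_corr \<omega> < 1"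
proof -
  note [measurable] = max_corr_measurable
  have "prob {\<omega> \<in> space M. 1 \<le> max_corr \<omega>} \<le> 0"
    using prob_max_corr_ge_le[of 1] by (simp add: corr_tail_1)
  then have "prob {\<omega> \<in> space M. 1 \<le> max_corr \<omega>} = 0"
    using measure_nonneg[of M "{\<omega> \<in> space M. 1 \<le> max_corr \<omega>}"] by linarith
  then have "AE \<omega> in M. \<omega> \<notin> {\<omega> \<in> space M. 1 \<le> max_corr \<omega>}"
    by (intro AE_not_in null_setsI) (simp_all add: emeasure_eq_measure)
  then show ?thesis
    using AE_space by eventually_elim auto
qed

text \<open>
  The equivalence fails where \<open>max_corr\<close> equals 1, since \<open>ln 0 = 0\<close>; that happens with probability 0.
\<close>

lemma prob_ln_max_corr_le:
  assumes s: "s < 0"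
  shows "prob {\<omega> \<in> space M. ln (1 - (max_corr \<omega>)\<^sup>2) \<le> s} = prob {\<omega> \<in> space M. sqrt (1 - exp s) \<le> max_corr \<omega>}"
proof (rule finite_measure_eq_AE)
  note [measurable] = max_corr_measurable
  show "{\<omega> \<in> space M. ln (1 - (max_corr \<omega>)\<^sup>2) \<le> s} \<in> events"
    "{\<omega> \<in> space M. sqrt (1 - exp s) \<le> max_corr \<omega>} \<in> events"
    by measurable
  show "AE \<omega> in M. (\<omega> \<in> {\<omega> \<in> space M. ln (1 - (max_corr \<omega>)\<^sup>2) \<le> s}) =
      (\<omega> \<in> {\<omega> \<in> space M. sqrt (1 - exp s) \<le> max_corr \<omega>})"
    using AE_max_corr_less_1
  proof eventually_elim
    case (elim \<omega>)
    then have pos: "1 - (max_corr \<omega>)\<^sup>2 > 0"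
      using max_corr_bounds(1)[of \<omega>] by (intro one_minus_square_pos) simp
    have "ln (1 - (max_corr \<omega>)\<^sup>2) \<le> s \<longleftrightarrow> 1 - (max_corr \<omega>)\<^sup>2 \<le> exp s"
      using pos by (metis exp_le_cancel_iff exp_ln)
    also have "\<dots> \<longleftrightarrow> 1 - exp s \<le> (max_corr \<omega>)\<^sup>2"
      by auto
    also have "\<dots> \<longleftrightarrow> sqrt (1 - exp s) \<le> sqrt ((max_corr \<omega>)\<^sup>2)"
      by (rule real_sqrt_le_iff[symmetric])
    also have "sqrt ((max_corr \<omega>)\<^sup>2) = max_corr \<omega>"
      using max_corr_bounds(1) by simp
    finally show ?case by simp
  qed
qed

end

end

lemma extreme_cdf:
  fixes K :: real
  assumes K: "K > 0"
  defines "F \<equiv> \<lambda>y. 1 - exp (- K * exp (y / 2))"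
  shows "real_distribution (interval_measure F)" "cdf (interval_measure F) = F"
proof -
  have mono: "F x \<le> F y" if "x \<le> y" for x y
    using that K by (simp add: F_def)
  have cont: "continuous (at_right a) F" for a
    unfolding F_def by (intro continuous_intros) auto
  have bot: "(F \<longlongrightarrow> 0) at_bot"
    unfolding F_def using K by real_asymp
  have top: "(F \<longlongrightarrow> 1) at_top"
    unfolding F_def using K by real_asymp
  show "real_distribution (interval_measure F)"
    by (rule real_distribution_interval_measure[OF mono cont bot top])
  show "cdf (interval_measure F) = F"
    by (rule cdf_interval_measure[OF mono cont bot])
qed

theorem theorem1:
  fixes M :: "nat \<Rightarrow> 'a measure"
    and p :: "nat \<Rightarrow> nat"
    and X :: "nat \<Rightarrow> nat \<Rightarrow> 'a \<Rightarrow> nat \<Rightarrow> real"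
    and L T :: "nat \<Rightarrow> 'a \<Rightarrow> real"
    and K :: real
  assumes "\<And>n. n \<ge> 1 \<Longrightarrow> prob_space (M n)"
    and "eventually (\<lambda>n. p n \<ge> 2) sequentially"
    and "(\<lambda>n. ln (real (p n)) / real n) \<longlonglongrightarrow> 0"
    and "\<And>n. n \<ge> 1 \<Longrightarrow> prob_space.indep_vars (M n) (\<lambda>_. Rn n) (X n) {1..p n}"
    and "\<And>n k. n \<ge> 1 \<Longrightarrow> k \<in> {1..p n} \<Longrightarrow> spherical (M n) n (X n k)"
    and "\<And>n k. n \<ge> 1 \<Longrightarrow> k \<in> {1..p n} \<Longrightarrow>
           distr (M n) (Rn n) (X n k) = distr (M n) (Rn n) (X n 1)"
    and "\<And>n. n \<ge> 1 \<Longrightarrow> measure (M n) {\<omega> \<in> space (M n). \<forall>i\<in>{1..n}. X n 1 \<omega> i = 0} = 0"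
    and "\<And>n \<omega>. L n \<omega> = max_abs_corr n (p n) (\<lambda>k. X n k \<omega>)"
    and "\<And>n \<omega>. T n \<omega> = ln (1 - (L n \<omega>)\<^sup>2)"
    and "K = 1 / sqrt (8 * pi)"
  shows "(\<forall>\<epsilon>>0. (\<lambda>n. measure (M n) {\<omega> \<in> space (M n). \<bar>L n \<omega> - 0\<bar> > \<epsilon>}) \<longlonglongrightarrow> 0) \<and>
         (filterlim p at_top sequentially \<longrightarrow>
         (\<exists>\<mu>. real_distribution \<mu> \<and> cdf \<mu> = (\<lambda>y. 1 - exp (- K * exp (y / 2))) \<and>
           weak_conv_m
             (\<lambda>n. distr (M n) borel
                (\<lambda>\<omega>. real n * T n \<omega> + 4 * ln (real (p n)) - ln (ln (real (p n))))) \<mu>))"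
proof (intro conjI allI impI)
  have sample: "\<forall>\<^sub>F n in sequentially.
      p n \<ge> 2 \<and> spherical_sample (M n) n (p n) (X n) (distr (M n) (Rn n) (X n 1))"
    using assms(2) eventually_ge_at_top[of 4]
  proof eventually_elim
    case (elim n)
    then have n: "n \<ge> 1" "n \<ge> 2" by auto
    interpret prob_space "M n" using n by (intro assms(1))
    have "spherical_law (distr (M n) (Rn n) (X n 1)) n"
      using n elim by (intro spherical_law_distr prob_space_axioms assms(5,7)) auto
    then have "spherical_sample (M n) n (p n) (X n) (distr (M n) (Rn n) (X n 1))"
      using elim assms(4)[OF n(1)] assms(6)[OF n(1)]
      by (intro spherical_sample.intro spherical_sample_axioms.intro prob_space_axioms)
    with elim show ?case by simp
  qed

  show "(\<lambda>n. measure (M n) {\<omega> \<in> space (M n). \<bar>L n \<omega> - 0\<bar> > \<epsilon>}) \<longlonglongrightarrow> 0" if "\<epsilon> > 0" for \<epsilon>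
  proof -
    \<comment> \<open>The tail bound needs a level below 1.\<close>
    define t where "t = min \<epsilon> (1 / 2)"
    have t: "0 < t" "t < 1" "t \<le> \<epsilon>"
      using that by (auto simp: t_def)
    have "(\<lambda>n. (real (p n))\<^sup>2 * corr_tail (n - 4) t) \<longlonglongrightarrow> 0"
      using assms(2) by (intro square_times_corr_tail_fixed assms(3) t) (auto elim: eventually_mono)
    then show ?thesis
    proof (rule tendsto_sandwich[OF _ _ tendsto_const, rotated 2])
      show "\<forall>\<^sub>F n in sequentially. measure (M n) {\<omega> \<in> space (M n). \<bar>L n \<omega> - 0\<bar> > \<epsilon>}
          \<le> (real (p n))\<^sup>2 * corr_tail (n - 4) t"
        using sample
      proof eventually_elim
        case (elim n)
        then interpret spherical_sample "M n" n "p n" "X n" "distr (M n) (Rn n) (X n 1)"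
          by simp
        have p2: "p n \<ge> 2" using elim by simp
        note [measurable] = max_corr_measurable
        have "measure (M n) {\<omega> \<in> space (M n). \<bar>L n \<omega> - 0\<bar> > \<epsilon>} \<le> prob {\<omega> \<in> space (M n). t \<le> max_corr \<omega>}"
          using max_corr_bounds(1)[OF p2] t by (intro finite_measure_mono) (auto simp: assms(8))
        also have "\<dots> \<le> (real (p n))\<^sup>2 * corr_tail (n - 4) t"
          by (rule prob_max_corr_ge_le[OF p2])
        finally show ?case .
      qed
    qed simp
  qed

  assume p_top: "filterlim p at_top sequentially"
  let ?F = "\<lambda>y. 1 - exp (- K * exp (y / 2))"
  let ?Z = "\<lambda>n \<omega>. real n * T n \<omega> + 4 * ln (real (p n)) - ln (ln (real (p n)))"
  have K: "K > 0"
    using assms(10) by simp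
  have conv: "(\<lambda>n. cdf (distr (M n) borel (?Z n)) y) \<longlonglongrightarrow> ?F y" for y
  proof -
    define s where "s = (\<lambda>n. (y - 4 * ln (real (p n)) + ln (ln (real (p n)))) / real n)"
    define q where "q = (\<lambda>n. corr_tail (n - 4) (sqrt (1 - exp (s n))))"
    define \<Lambda> where "\<Lambda> = (\<lambda>n. real (p n) * (real (p n) - 1) / 2 * q n)"
    have crit: "\<forall>\<^sub>F n in sequentially. s n < 0" "\<Lambda> \<longlonglongrightarrow> exp (y / 2) / sqrt (8 * pi)"
        "(\<lambda>n. 4 * real (p n) ^ 3 * (q n)\<^sup>2) \<longlonglongrightarrow> 0"
      unfolding s_def q_def \<Lambda>_def by (rule pairs_times_corr_tail_critical[OF p_top assms(3)])+
    have "(\<lambda>n. 1 - exp (- \<Lambda> n)) \<longlonglongrightarrow> 1 - exp (- (exp (y / 2) / sqrt (8 * pi)))"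
      by (intro tendsto_intros crit(2))
    then have lim: "(\<lambda>n. 1 - exp (- \<Lambda> n)) \<longlonglongrightarrow> ?F y"
      by (simp add: assms(10))
    have "(\<lambda>n. cdf (distr (M n) borel (?Z n)) y - (1 - exp (- \<Lambda> n))) \<longlonglongrightarrow> 0"
    proof (rule Lim_null_comparison[OF _ crit(3)])
      show "\<forall>\<^sub>F n in sequentially. norm (cdf (distr (M n) borel (?Z n)) y - (1 - exp (- \<Lambda> n)))
          \<le> 4 * real (p n) ^ 3 * (q n)\<^sup>2"
        using sample crit(1) eventually_gt_at_top[of 0]
      proof eventually_elim
        case (elim n)
        then interpret spherical_sample "M n" n "p n" "X n" "distr (M n) (Rn n) (X n 1)"
          by simp
        have p2: "p n \<ge> 2" using elim by simp
        note [measurable] = max_corr_measurable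
        have Z: "?Z n \<omega> = real n * ln (1 - (max_corr \<omega>)\<^sup>2) + 4 * ln (real (p n)) - ln (ln (real (p n)))" for \<omega>
          by (simp add: assms(8,9))
        have "?Z n \<in> borel_measurable (M n)"
          unfolding Z by measurable
        then have "cdf (distr (M n) borel (?Z n)) y = prob {\<omega> \<in> space (M n). ?Z n \<omega> \<le> y}"
          by (simp add: cdf_def measure_distr vimage_def Int_def conj_commute)
        also have "{\<omega> \<in> space (M n). ?Z n \<omega> \<le> y} = {\<omega> \<in> space (M n). ln (1 - (max_corr \<omega>)\<^sup>2) \<le> s n}"
          using elim unfolding Z by (auto simp: s_def field_simps)
        also have "prob \<dots> = prob {\<omega> \<in> space (M n). sqrt (1 - exp (s n)) \<le> max_corr \<omega>}"
          using elim by (intro prob_ln_max_corr_le p2) simp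
        finally show ?case
          using prob_max_corr_ge_approx[OF p2, of "sqrt (1 - exp (s n))"] by (simp add: q_def \<Lambda>_def)
      qed
    qed
    from tendsto_add[OF this lim] show ?thesis
      by simp
  qed
  show "\<exists>\<mu>. real_distribution \<mu> \<and> cdf \<mu> = ?F \<and> weak_conv_m (\<lambda>n. distr (M n) borel (?Z n)) \<mu>"
  proof (intro exI[of _ "interval_measure ?F"] conjI)
    show "real_distribution (interval_measure ?F)" "cdf (interval_measure ?F) = ?F"
      by (rule extreme_cdf[OF K])+
    then show "weak_conv_m (\<lambda>n. distr (M n) borel (?Z n)) (interval_measure ?F)"
      using conv by (simp add: weak_conv_m_def weak_conv_def)
  qed
qed

end
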